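(* Let $L,M,N$ be positive integers with $M<L$, let $r\in\{1,\ldots,L-1\}$ and let $k$ be an integer with $\max\{N,N-L+M+r\}\leq k\leq\min\{M+N-1,r+N-1\}$. Then $$G_{L,M,N}^{r,k}=G_{L,M,N}\prod_{j=k}^{\min\{M+N-1,\,r+N-1\}}\frac{1}{p_{N-1+r-j}(0)},$$ where $G_{L,M,N}$ and $G_{L,M,N}^{r,k}$ are the numbers of lozenge tilings of the hexagon $H_{L,M,N}$ and of the reduced hexagon $H_{L,M,N}^{r,k}$, and $p_{N-1+r-j}$ is the polynomial determined by the type I Hermite–Padé approximation problem in the context, with parameter $j$.
   Context: The hexagon $H_{L,M,N}$ is the closed hexagon in $\mathbb R^2$ with corners $(0,0)$, $(L-M,0)$, $(L,M)$, $(L,M+N)$, $(M,M+N)$, $(0,N)$. The reduced hexagon $H_{L,M,N}^{r,k}$ is the intersection of $H_{L,M,N}$ with $\{(x,y)\in\mathbb R^2:\ y\leq\max\{k,\ x+k-r\}\}$. Lozenges are the translates, by vectors of $\mathbb Z^2$, of the three parallelograms with vertices $(0,0),(0,1),(1,2),(1,1)$; $(0,0),(0,1),(1,1),(1,0)$; $(0,0),(1,1),(2,1),(1,0)$. A lozenge tiling of a region is a collection of lozenges contained in the region with pairwise disjoint interiors whose union is the region. $G_{L,M,N}$ is the number of lozenge tilings of $H_{L,M,N}$ (by MacMahon's formula, $G_{L,M,N}=\prod_{i=1}^{L-M}\prod_{j=1}^{M}\prod_{l=1}^{N}\frac{i+j+l-1}{i+j+l-2}$), and $G_{L,M,N}^{r,k}$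 is the number of lozenge tilings of $H_{L,M,N}^{r,k}$. Hermite–Padé problem with parameter $j$ (for integers $j$ with $\max\{N,N-L+M+r\}\leq j\leq\min\{M+N-1,r+N-1\}$): find a polynomial $q_{M-1}$ of degree at most $M-1$, a polynomial $p_{N-1+r-j}$ of degree at most $N-1+r-j$, and a monic polynomial $P_{L-M-N+j-r}$ of degree $L-M-N+j-r$, such that $$q_{M-1}(z)-z^{M+N}P_{L-M-N+j-r}(z)+(1+z)^{L-r}z^{j}p_{N-1+r-j}(z)=O((z+1)^L)\qquad\text{as } z\to -1.$$ This is a linear system of $L$ equations for the $L$ unknown coefficients, and it has a unique solution (all three polynomials depend on $j$). *)

theory Defs
  imports
    "HOL-Analysis.Analysis"
    "HOL-Computational_Algebra.Polynomial"
    "HOL-Library.Landau_Symbols"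
begin

definition hexagon :: "int \<Rightarrow> int \<Rightarrow> int \<Rightarrow> (real \<times> real) set" where
  "hexagon L M N = convex hull
     {(0, 0), (of_int (L - M), 0), (of_int L, of_int M),
      (of_int L, of_int (M + N)), (of_int M, of_int (M + N)), (0, of_int N)}"

definition reduced_hexagon :: "int \<Rightarrow> int \<Rightarrow> int \<Rightarrow> int \<Rightarrow> int \<Rightarrow> (real \<times> real) set" where
  "reduced_hexagon L M N r k =
     hexagon L M N \<inter> {(x, y). y \<le> max (of_int k) (x + of_int k - of_int r)}"

definition basic_lozenges :: "(real \<times> real) set set" where
  "basic_lozenges =
     {convex hull {(0, 0), (0, 1), (1, 2), (1, 1)},
      convex hull {(0, 0), (0, 1), (1, 1), (1, 0)},
      convex hull {(0, 0), (1, 1), (2, 1), (1, 0)}}"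

definition lozenges :: "(real \<times> real) set set" where
  "lozenges = {(\<lambda>v. v + (of_int a, of_int b)) ` B | (a::int) (b::int) B. B \<in> basic_lozenges}"

definition lozenge_tiling :: "(real \<times> real) set \<Rightarrow> (real \<times> real) set set \<Rightarrow> bool" where
  "lozenge_tiling R T \<longleftrightarrow>
     T \<subseteq> lozenges \<and> (\<forall>A\<in>T. A \<subseteq> R) \<and>
     pairwise (\<lambda>A B. interior A \<inter> interior B = {}) T \<and> \<Union>T = R"

(* A bounded region contains only finitely many lozenges, so the cardinality below is the
   true number of tilings for the regions considered here. *)
definition num_tilings :: "(real \<times> real) set \<Rightarrow> nat" where
  "num_tilings R = card {T. lozenge_tiling R T}"

definition G_hex :: "int \<Rightarrow> int \<Rightarrow> int \<Rightarrow> nat" where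
  "G_hex L M N = num_tilings (hexagon L M N)"

definition G_red :: "int \<Rightarrow> int \<Rightarrow> int \<Rightarrow> int \<Rightarrow> int \<Rightarrow> nat" where
  "G_red L M N r k = num_tilings (reduced_hexagon L M N r k)"

(* For max N (N - L + M + r) \<le> j \<le> min (M + N - 1) (r + N - 1) all degree bounds and all
   exponents below are nonnegative, so nothing is truncated by nat. *)
definition hermite_pade ::
  "int \<Rightarrow> int \<Rightarrow> int \<Rightarrow> int \<Rightarrow> int \<Rightarrow> complex poly \<times> complex poly \<times> complex poly \<Rightarrow> bool" where
  "hermite_pade L M N r j = (\<lambda>(q, p, P).
     int (degree q) \<le> M - 1 \<and>
     int (degree p) \<le> N - 1 + r - j \<and>
     int (degree P) = L - M - N + j - r \<and> lead_coeff P = 1 \<and>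
     (\<lambda>z. poly q z - z ^ nat (M + N) * poly P z + (1 + z) ^ nat (L - r) * z ^ nat j * poly p z)
       \<in> O[at (- 1)](\<lambda>z. (z + 1) ^ nat L))"

(* The middle component of the unique solution of the Hermite-Pade problem with parameter j. *)
definition hermite_pade_p :: "int \<Rightarrow> int \<Rightarrow> int \<Rightarrow> int \<Rightarrow> int \<Rightarrow> complex poly" where
  "hermite_pade_p L M N r j = fst (snd (THE s. hermite_pade L M N r j s))"

end

theory Submission
  imports Defs "Jordan_Normal_Form.Determinant"
begin

text \<open>Cut the plane into columns of width one and each column into triangles. A lozenge is a pair of
adjacent triangles, so a tiling of a region made of triangles is a perfect matching of them. In a
hexagon, following the lozenges that have two vertical sides from left to right turns such a matching
into \<open>N\<close> nonintersecting lattice paths: path \<open>i\<close> starts at height \<open>i\<close>, ends after \<open>L\<close> steps at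
height \<open>M + i\<close>, and each step keeps the height or raises it by one. The part of the hexagon that the
parameters \<open>r\<close> and \<open>k\<close> remove forces the paths, at time \<open>r\<close>, to be strictly below \<open>k\<close>; as every
step rises by zero or one, this single condition is equivalent to staying in the reduced hexagon. So
the number of tilings of the reduced hexagon is the number \<open>G(k)\<close> of such path families
(\<open>num_tilings_reduced_hexagon\<close>). The whole hexagon is the case in which \<open>k\<close> is the smaller of
\<open>M + N\<close> and \<open>r + N\<close>, where nothing is removed.

The numbers \<open>G(j)\<close> are determinants. Eliminating the error term, the Hermite-Pade problem asks to
write \<open>z\<^sup>L\<^sup>-\<^sup>r\<^sup>+\<^sup>j\<close> as a linear combination of the \<open>L + N\<close> polynomials

  \<open>z\<^sup>i\<close> for \<open>i < M\<close> and for \<open>M + N \<le> i < L - r + j\<close>,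
  \<open>(1 + z)\<^sup>L\<^sup>-\<^sup>r z\<^sup>i\<close> for \<open>j \<le> i < N + r\<close>,
  \<open>(1 + z)\<^sup>L z\<^sup>i\<close> for \<open>i < N\<close>,

all of degree less than \<open>L + N\<close>. Let \<open>D(j)\<close> be the determinant of their coefficients. To evaluate it,
strip one factor \<open>1 + z\<close> at a time from the last group:
\<open>(1 + z)\<^sup>m\<^sup>+\<^sup>1 z\<^sup>x = (1 + z)\<^sup>m z\<^sup>x + (1 + z)\<^sup>m z\<^sup>x\<^sup>+\<^sup>1\<close>, so by multilinearity each factor is one time step of the
path family. Two paths that meet produce equal rows, and so does a path that at time \<open>r\<close> has height
at least \<open>j\<close>, because it meets a row of the second group; a family that ends at the wrong heights
meets a row of the first group. The surviving families contribute a unitriangular determinant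
each. Hence \<open>D(j) = G(j)\<close> (\<open>pade_det_eq_card\<close>), without any signs to track. This
is nonzero, since some family exists, and therefore the Hermite-Pade problem has a unique solution.

The value of its polynomial \<open>p\<close> at \<open>0\<close> is the coefficient of \<open>(1 + z)\<^sup>L\<^sup>-\<^sup>r z\<^sup>j\<close> in the linear
combination. By Cramer's rule it is the quotient of two determinants, and the numerator, in which
\<open>z\<^sup>L\<^sup>-\<^sup>r\<^sup>+\<^sup>j\<close> replaces \<open>(1 + z)\<^sup>L\<^sup>-\<^sup>r z\<^sup>j\<close>, is exactly \<open>D(j + 1)\<close>. So \<open>p(0) = G(j + 1) / G(j)\<close>
(\<open>hermite_pade_p_at_0\<close>), and the product in the theorem telescopes.\<close>

section \<open>Triangular cells and lozenges\<close>

text \<open>The triangles of column \<open>a\<close>, the strip \<open>a \<le> x \<le> a + 1\<close>, are stacked on top of each other, and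
consecutive ones are separated by alternating segments: the horizontal one at height \<open>b\<close>, which gets
the index \<open>2 * b\<close>, and the diagonal from \<open>(a, b)\<close> to \<open>(a + 1, b + 1)\<close>, which gets the index \<open>2 * b + 1\<close>.
Numbering both kinds by one integer makes every column a chain.\<close>

definition sep :: "int \<Rightarrow> int \<Rightarrow> real \<Rightarrow> real" where
  "sep a i x = of_int (i div 2) + of_int (i mod 2) * (x - of_int a)"

definition cell :: "int \<times> int \<Rightarrow> (real \<times> real) set" where
  "cell = (\<lambda>(a, i). {(x, y). of_int a \<le> x \<and> x \<le> of_int a + 1 \<and> sep a i x \<le> y \<and> y \<le> sep a (i + 1) x})"

text \<open>The lozenge \<open>Col a i\<close> consists of two consecutive triangles of column \<open>a\<close>: it is a unit square for even
\<open>i\<close> and the lozenge with vertical and diagonal sides for odd \<open>i\<close>. The lozenge \<open>Hor a b\<close> has no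
vertical side; it covers the vertical edge from \<open>(a + 1, b)\<close> to \<open>(a + 1, b + 1)\<close> between columns \<open>a\<close>
and \<open>a + 1\<close>.\<close>

datatype tile = Col int int | Hor int int

fun cells :: "tile \<Rightarrow> (int \<times> int) set" where
  "cells (Col a i) = {(a, i), (a, i + 1)}"
| "cells (Hor a b) = {(a, 2 * b), (a + 1, 2 * b + 1)}"

definition tile_set :: "tile \<Rightarrow> (real \<times> real) set" where
  "tile_set d = \<Union>(cell ` cells d)"

definition discrete_tiling :: "(int \<times> int) set \<Rightarrow> tile set \<Rightarrow> bool" where
  "discrete_tiling C D \<longleftrightarrow> (\<forall>d\<in>D. cells d \<subseteq> C) \<and> (\<forall>t\<in>C. \<exists>!d. d \<in> D \<and> t \<in> cells d)"

lemma sep_even: "sep a (2 * b) x = of_int b"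
  by (simp add: sep_def)

lemma sep_odd: "sep a (2 * b + 1) x = of_int b + (x - of_int a)"
  by (simp add: sep_def)

lemma sep_add_2: "sep a (i + 2) x = sep a i x + 1"
  by (simp add: sep_def)

lemma int_parity_cases:
  obtains b where "i = 2 * b" | b where "i = 2 * b + (1::int)"
  by (metis oddE evenE)

lemma sep_Suc_le:
  assumes "of_int a \<le> x" "x \<le> of_int a + 1"
  shows "sep a i x \<le> sep a (i + 1) x"
proof (cases i rule: int_parity_cases)
  case (1 b)
  then show ?thesis using assms by (simp add: sep_even sep_odd)
next
  case (2 b)
  have "sep a (i + 1) x = of_int (b + 1)" using sep_even[of a "b + 1" x] 2 by (simp add: algebra_simps)
  then show ?thesis using assms 2 by (simp add: sep_odd)
qed

lemma sep_mono:
  assumes "of_int a \<le> x" "x \<le> of_int a + 1" "i \<le> j"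
  shows "sep a i x \<le> sep a j x"
  using assms(3)
proof (induction j rule: int_ge_induct)
  case (step j)
  then show ?case using sep_Suc_le[OF assms(1,2), of j] by linarith
qed simp

text \<open>A discrete intermediate value argument along the chain of separators.\<close>

lemma sep_between:
  assumes "m < n" "sep a m x \<le> y" "y \<le> sep a n x"
  shows "\<exists>i. m \<le> i \<and> i < n \<and> sep a i x \<le> y \<and> y \<le> sep a (i + 1) x"
  using assms(1,3)
proof (induction n rule: int_gr_induct)
  case base
  then show ?case using assms(2) by (intro exI[of _ m]) auto
next
  case (step n)
  show ?case
  proof (cases "y \<le> sep a n x")
    case True
    then show ?thesis using step.IH by fastforce
  next
    case False
    then show ?thesis using step by (intro exI[of _ n]) auto
  qed
qed

text \<open>Points off all lines that carry an edge of a triangle. Such a point lies in only one triangle, and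
every nonempty open set contains one; together this reduces all statements about interiors and
coverings to finite incidences.\<close>

definition generic :: "real \<times> real \<Rightarrow> bool" where
  "generic = (\<lambda>(x, y). x \<notin> \<int> \<and> y \<notin> \<int> \<and> y - x \<notin> \<int>)"

lemma generic_cell_unique:
  assumes z: "generic z" and t: "z \<in> cell t" and t': "z \<in> cell t'"
  shows "t = t'"
proof -
  obtain x y where zz: "z = (x, y)" by (cases z)
  obtain a i where tt: "t = (a, i)" by (cases t)
  obtain a' i' where tt': "t' = (a', i')" by (cases t')
  have ne: "x \<noteq> of_int c" "y \<noteq> of_int c" "y - x \<noteq> of_int c" for c
    using z by (auto simp: generic_def zz)
  have b: "of_int a \<le> x" "x \<le> of_int a + 1" "sep a i x \<le> y" "y \<le> sep a (i + 1) x"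
    using t by (auto simp: cell_def zz tt)
  have b': "of_int a' \<le> x" "x \<le> of_int a' + 1" "sep a' i' x \<le> y" "y \<le> sep a' (i' + 1) x"
    using t' by (auto simp: cell_def zz tt')
  have "of_int a < x" "x < of_int (a + 1)" "of_int a' < x" "x < of_int (a' + 1)"
    using b(1,2) b'(1,2) ne(1)[of a] ne(1)[of "a + 1"] ne(1)[of a'] ne(1)[of "a' + 1"] by auto
  then have "of_int a < (of_int (a' + 1) :: real)" "of_int a' < (of_int (a + 1) :: real)" by linarith+
  then have aa: "a' = a" by linarith
  have nsep: "sep a k x \<noteq> y" for k
  proof (cases k rule: int_parity_cases)
    case (1 b)
    then show ?thesis using ne(2)[of b] by (simp add: sep_even)
  next
    case (2 b)
    then show ?thesis using ne(3)[of "b - a"] by (auto simp: sep_odd)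
  qed
  have "\<not> i < i'"
  proof
    assume "i < i'"
    then have "sep a (i + 1) x \<le> sep a i' x" using sep_mono[OF b(1,2)] by simp
    then show False using b(4) b'(3) nsep[of i'] by (simp add: aa)
  qed
  moreover have "\<not> i' < i"
  proof
    assume "i' < i"
    then have "sep a (i' + 1) x \<le> sep a i x" using sep_mono[OF b(1,2)] by simp
    then show False using b'(4) b(3) nsep[of i] by (simp add: aa)
  qed
  ultimately show ?thesis by (simp add: tt tt' aa)
qed

text \<open>Both coordinates only have to avoid countably many values.\<close>

lemma open_contains_generic:
  assumes "open U" "U \<noteq> {}"
  shows "\<exists>z\<in>U. generic z"
proof -
  obtain z where "z \<in> U" using assms by blast
  then obtain A B where AB: "open A" "open B" "z \<in> A \<times> B" "A \<times> B \<subseteq> U"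
    by (rule open_prod_elim[OF assms(1)])
  have cZ: "countable (\<int> :: real set)" unfolding Ints_def by simp
  obtain x where x: "x \<in> A" "x \<notin> \<int>"
    using open_minus_countable[OF cZ _ AB(1)] AB(3) by blast
  have "countable (\<int> \<union> (+) x ` \<int>)" using cZ by simp
  then obtain y where y: "y \<in> B" "y \<notin> \<int> \<union> (+) x ` \<int>"
    using open_minus_countable[OF _ _ AB(2)] AB(3) by blast
  have "y - x \<notin> \<int>"
  proof
    assume "y - x \<in> \<int>"
    then have "x + (y - x) \<in> (+) x ` \<int>" by blast
    then show False using y by simp
  qed
  then have "generic (x, y)" using x y by (simp add: generic_def)
  then show ?thesis using x(1) y(1) AB(4) by blast
qed

lemma interior_cell_nonempty: "interior (cell t) \<noteq> {}"
proof -
  obtain a i where t: "t = (a, i)" by (cases t)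
  define U where "U = {z. of_int a < fst z \<and> fst z < of_int a + 1 \<and> sep a i (fst z) < snd z \<and> snd z < sep a (i + 1) (fst z)}"
  have "open U"
    unfolding U_def sep_def by (intro open_Collect_conj open_Collect_less continuous_intros)
  moreover have "U \<subseteq> cell t" by (auto simp: U_def cell_def t)
  moreover have "(of_int a + 1/2, of_int i / 2 + 1/4) \<in> U"
  proof -
    \<comment> \<open>On the middle line of a column the separators are equally spaced.\<close>
    have half: "sep a k (of_int a + 1/2) = of_int k / 2" for k
    proof (cases k rule: int_parity_cases)
      case (2 b)
      then show ?thesis by (simp add: sep_odd add_divide_distrib)
    qed (simp add: sep_even)
    show ?thesis by (simp add: U_def half)
  qed
  ultimately show ?thesis using interior_maximal[of U "cell t"] by blast
qed

text \<open>A witness for each triangle: a tile or a union of cells contains the triangle as soon as it contains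
this point.\<close>

definition sample :: "int \<times> int \<Rightarrow> real \<times> real" where
  "sample t = (SOME z. z \<in> interior (cell t) \<and> generic z)"

lemma sample_point: "sample t \<in> interior (cell t)" "generic (sample t)"
proof -
  have "\<exists>z. z \<in> interior (cell t) \<and> generic z"
    using open_contains_generic[OF open_interior interior_cell_nonempty[of t]] by blast
  then show "sample t \<in> interior (cell t)" "generic (sample t)"
    unfolding sample_def by (metis (mono_tags, lifting) someI_ex)+
qed

lemma sample_in_cell: "sample t \<in> cell t"
  using sample_point(1) by (rule subsetD[OF interior_subset])

lemma sample_in_Union_cells: "sample t \<in> \<Union>(cell ` C) \<longleftrightarrow> t \<in> C"
proof
  assume "sample t \<in> \<Union>(cell ` C)"
  then obtain t' where "t' \<in> C" "sample t \<in> cell t'" by auto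
  then show "t \<in> C" using generic_cell_unique[OF sample_point(2) sample_in_cell] by blast
next
  assume "t \<in> C"
  then show "sample t \<in> \<Union>(cell ` C)" using sample_in_cell by blast
qed

lemma sample_in_tile_set: "sample t \<in> tile_set d \<longleftrightarrow> t \<in> cells d"
  unfolding tile_set_def by (rule sample_in_Union_cells)

lemma inj_cells: "cells d = cells d' \<Longrightarrow> d = d'"
  by (cases d; cases d') (auto simp: doubleton_eq_iff)

lemma tile_set_inj: "inj tile_set"
proof (rule injI)
  fix d d' assume "tile_set d = tile_set d'"
  then have "t \<in> cells d \<longleftrightarrow> t \<in> cells d'" for t by (simp flip: sample_in_tile_set)
  then have "cells d = cells d'" by blast
  then show "d = d'" by (rule inj_cells)
qed

lemma tile_set_subset_iff: "tile_set d \<subseteq> \<Union>(cell ` C) \<longleftrightarrow> cells d \<subseteq> C"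
proof
  assume "tile_set d \<subseteq> \<Union>(cell ` C)"
  then have "t \<in> cells d \<longrightarrow> t \<in> C" for t
    using sample_in_tile_set[of t d] sample_in_Union_cells[of t C] by blast
  then show "cells d \<subseteq> C" by blast
qed (auto simp: tile_set_def)

lemma interiors_disjoint_iff:
  "interior (tile_set d) \<inter> interior (tile_set d') = {} \<longleftrightarrow> cells d \<inter> cells d' = {}"
proof
  assume disj: "interior (tile_set d) \<inter> interior (tile_set d') = {}"
  show "cells d \<inter> cells d' = {}"
  proof (rule ccontr)
    assume "cells d \<inter> cells d' \<noteq> {}"
    then obtain t where "t \<in> cells d" "t \<in> cells d'" by blast
    then have "cell t \<subseteq> tile_set d" "cell t \<subseteq> tile_set d'" by (auto simp: tile_set_def)
    then have "sample t \<in> interior (tile_set d) \<inter> interior (tile_set d')"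
      using sample_point(1)[of t] interior_mono[of "cell t"] by blast
    then show False using disj by blast
  qed
next
  assume disj: "cells d \<inter> cells d' = {}"
  show "interior (tile_set d) \<inter> interior (tile_set d') = {}"
  proof (rule ccontr)
    assume "interior (tile_set d) \<inter> interior (tile_set d') \<noteq> {}"
    then obtain z where z: "z \<in> interior (tile_set d)" "z \<in> interior (tile_set d')" "generic z"
      using open_contains_generic[of "interior (tile_set d) \<inter> interior (tile_set d')"] by blast
    then have "z \<in> tile_set d" "z \<in> tile_set d'"
      using interior_subset[of "tile_set d"] interior_subset[of "tile_set d'"] by auto
    then obtain t t' where "t \<in> cells d" "z \<in> cell t" "t' \<in> cells d'" "z \<in> cell t'"
      unfolding tile_set_def by blast
    then show False using generic_cell_unique[OF z(3)] disj by blast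
  qed
qed

lemma Union_tile_sets_iff:
  assumes "\<And>d. d \<in> D \<Longrightarrow> cells d \<subseteq> C"
  shows "\<Union>(tile_set ` D) = \<Union>(cell ` C) \<longleftrightarrow> (\<forall>t\<in>C. \<exists>d\<in>D. t \<in> cells d)"
proof
  assume eq: "\<Union>(tile_set ` D) = \<Union>(cell ` C)"
  show "\<forall>t\<in>C. \<exists>d\<in>D. t \<in> cells d"
  proof
    fix t assume "t \<in> C"
    then have "sample t \<in> \<Union>(tile_set ` D)" unfolding eq by (simp add: sample_in_Union_cells del: Union_iff UN_iff)
    then show "\<exists>d\<in>D. t \<in> cells d" by (auto simp: sample_in_tile_set)
  qed
next
  assume "\<forall>t\<in>C. \<exists>d\<in>D. t \<in> cells d"
  then show "\<Union>(tile_set ` D) = \<Union>(cell ` C)"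
    using assms unfolding tile_set_def by fastforce
qed

text \<open>The converse inclusion runs through a convex combination of convex combinations on two opposite sides.\<close>

lemma convex_hull_parallelogram:
  fixes u v :: "'a::real_vector"
  shows "convex hull {0, u, u + v, v} = {s *\<^sub>R u + t *\<^sub>R v | s t. 0 \<le> s \<and> s \<le> 1 \<and> 0 \<le> t \<and> t \<le> 1}"
    (is "_ = ?P")
proof
  have "convex ?P"
  proof (rule convexI)
    fix p q :: 'a and a b :: real
    assume "p \<in> ?P" "q \<in> ?P" and ab: "0 \<le> a" "0 \<le> b" "a + b = 1"
    then obtain s t s' t' where p: "p = s *\<^sub>R u + t *\<^sub>R v" "0 \<le> s" "s \<le> 1" "0 \<le> t" "t \<le> 1"
      and q: "q = s' *\<^sub>R u + t' *\<^sub>R v" "0 \<le> s'" "s' \<le> 1" "0 \<le> t'" "t' \<le> 1" by blast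
    have "a *\<^sub>R p + b *\<^sub>R q = (a * s + b * s') *\<^sub>R u + (a * t + b * t') *\<^sub>R v"
      by (simp add: p q algebra_simps)
    moreover have "0 \<le> a * s + b * s'" "0 \<le> a * t + b * t'" using p q ab by auto
    moreover have "a * s + b * s' \<le> 1" "a * t + b * t' \<le> 1"
      using p q ab by (auto intro: convex_bound_le)
    ultimately show "a *\<^sub>R p + b *\<^sub>R q \<in> ?P" by blast
  qed
  moreover have "{0, u, u + v, v} \<subseteq> ?P"
  proof -
    have "0 = 0 *\<^sub>R u + 0 *\<^sub>R v" "u = 1 *\<^sub>R u + 0 *\<^sub>R v" "u + v = 1 *\<^sub>R u + 1 *\<^sub>R v" "v = 0 *\<^sub>R u + 1 *\<^sub>R v"
      by auto
    moreover have "(0::real) \<le> 0" "(0::real) \<le> 1" "(1::real) \<le> 1" by auto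
    ultimately show ?thesis by blast
  qed
  ultimately show "convex hull {0, u, u + v, v} \<subseteq> ?P" by (rule hull_minimal[rotated])
next
  show "?P \<subseteq> convex hull {0, u, u + v, v}"
  proof
    fix p assume "p \<in> ?P"
    then obtain s t where p: "p = s *\<^sub>R u + t *\<^sub>R v" and st: "0 \<le> s" "s \<le> 1" "0 \<le> t" "t \<le> 1" by blast
    let ?H = "convex hull {0, u, u + v, v}"
    have H: "0 \<in> ?H" "u \<in> ?H" "u + v \<in> ?H" "v \<in> ?H" by (auto intro: hull_inc)
    note cv = convexD[OF convex_convex_hull, of _ "{0, u, u + v, v}"]
    have "(1 - s) *\<^sub>R 0 + s *\<^sub>R u \<in> ?H" by (rule cv[OF H(1,2)]) (use st in auto)
    moreover have "(1 - s) *\<^sub>R v + s *\<^sub>R (u + v) \<in> ?H" by (rule cv[OF H(4,3)]) (use st in auto)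
    ultimately have "(1 - t) *\<^sub>R ((1 - s) *\<^sub>R 0 + s *\<^sub>R u) + t *\<^sub>R ((1 - s) *\<^sub>R v + s *\<^sub>R (u + v)) \<in> ?H"
      by (rule cv) (use st in auto)
    then show "p \<in> ?H" by (simp add: p algebra_simps)
  qed
qed

lemma tile_set_Col:
  "tile_set (Col a i) = {(x, y). of_int a \<le> x \<and> x \<le> of_int a + 1 \<and> sep a i x \<le> y \<and> y \<le> sep a i x + 1}"
  (is "_ = ?S")
proof (rule Set.set_eqI)
  fix z :: "real \<times> real"
  obtain x y where z: "z = (x, y)" by (cases z)
  show "z \<in> tile_set (Col a i) \<longleftrightarrow> z \<in> ?S"
    using sep_Suc_le[of a x i] sep_Suc_le[of a x "i + 1"] sep_add_2[of a i x]
    by (auto simp: tile_set_def cell_def z add.assoc)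
qed

lemma tile_set_Hor:
  "tile_set (Hor a b) = {(x, y). of_int b \<le> y \<and> y \<le> of_int b + 1 \<and>
     of_int a + (y - of_int b) \<le> x \<and> x \<le> of_int a + 1 + (y - of_int b)}"
  (is "_ = ?S")
proof (rule Set.set_eqI)
  fix z :: "real \<times> real"
  obtain x y where z: "z = (x, y)" by (cases z)
  have "sep (a + 1) (2 * b + 1 + 1) x = of_int b + 1"
    using sep_even[of "a + 1" "b + 1" x] by (simp add: algebra_simps)
  then show "z \<in> tile_set (Hor a b) \<longleftrightarrow> z \<in> ?S"
    by (auto simp: tile_set_def cell_def z sep_even sep_odd)
qed

lemma parallelogram_translate:
  "(\<lambda>v. v + (p, q)) ` (convex hull {0, (u1, u2), (u1, u2) + (v1, v2), (v1, v2)})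
    = {(s * u1 + t * v1 + p, s * u2 + t * v2 + q) | s t. 0 \<le> s \<and> s \<le> 1 \<and> 0 \<le> t \<and> t \<le> (1 :: real)}"
  unfolding convex_hull_parallelogram by (auto simp: image_iff) (blast | force)+

lemma lozenge_Col_odd:
  "(\<lambda>v. v + (of_int a, of_int b)) ` (convex hull {(0, 0), (0, 1), (1, 2), (1, 1)}) = tile_set (Col a (2 * b + 1))"
proof -
  have eq: "{(0, 0), (0, 1), (1, 2), (1, 1)} = {0, (0, 1), (0, 1) + (1, 1), (1, 1 :: real) :: real \<times> real}"
    by (simp add: zero_prod_def)
  show ?thesis
    unfolding eq parallelogram_translate tile_set_Col sep_odd
  proof (intro Set.set_eqI iffI)
    fix z :: "real \<times> real"
    assume "z \<in> {(x, y). of_int a \<le> x \<and> x \<le> of_int a + 1 \<and> of_int b + (x - of_int a) \<le> y \<and> y \<le> of_int b + (x - of_int a) + 1}"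
    then show "z \<in> {(s * 0 + t * 1 + of_int a, s * 1 + t * 1 + of_int b) | s t. 0 \<le> s \<and> s \<le> 1 \<and> 0 \<le> t \<and> t \<le> 1}"
      by (cases z) (simp, rule exI[of _ "snd z - of_int b - (fst z - of_int a)"], rule exI[of _ "fst z - of_int a"], simp)
  qed auto
qed

lemma lozenge_Col_even:
  "(\<lambda>v. v + (of_int a, of_int b)) ` (convex hull {(0, 0), (0, 1), (1, 1), (1, 0)}) = tile_set (Col a (2 * b))"
proof -
  have eq: "{(0, 0), (0, 1), (1, 1), (1, 0)} = {0, (0, 1), (0, 1) + (1, 0), (1, 0 :: real) :: real \<times> real}"
    by (simp add: zero_prod_def)
  show ?thesis
    unfolding eq parallelogram_translate tile_set_Col sep_even
  proof (intro Set.set_eqI iffI)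
    fix z :: "real \<times> real"
    assume "z \<in> {(x, y). of_int a \<le> x \<and> x \<le> of_int a + 1 \<and> of_int b \<le> y \<and> y \<le> of_int b + 1}"
    then show "z \<in> {(s * 0 + t * 1 + of_int a, s * 1 + t * 0 + of_int b) | s t. 0 \<le> s \<and> s \<le> 1 \<and> 0 \<le> t \<and> t \<le> 1}"
      by (cases z) (simp, rule exI[of _ "snd z - of_int b"], rule exI[of _ "fst z - of_int a"], simp)
  qed auto
qed

lemma lozenge_Hor:
  "(\<lambda>v. v + (of_int a, of_int b)) ` (convex hull {(0, 0), (1, 1), (2, 1), (1, 0)}) = tile_set (Hor a b)"
proof -
  have eq: "{(0, 0), (1, 1), (2, 1), (1, 0)} = {0, (1, 1), (1, 1) + (1, 0), (1, 0 :: real) :: real \<times> real}"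
    by (simp add: zero_prod_def)
  show ?thesis
    unfolding eq parallelogram_translate tile_set_Hor
  proof (intro Set.set_eqI iffI)
    fix z :: "real \<times> real"
    assume "z \<in> {(x, y). of_int b \<le> y \<and> y \<le> of_int b + 1 \<and> of_int a + (y - of_int b) \<le> x \<and> x \<le> of_int a + 1 + (y - of_int b)}"
    then show "z \<in> {(s * 1 + t * 1 + of_int a, s * 1 + t * 0 + of_int b) | s t. 0 \<le> s \<and> s \<le> 1 \<and> 0 \<le> t \<and> t \<le> 1}"
      by (cases z) (simp, rule exI[of _ "snd z - of_int b"], rule exI[of _ "fst z - of_int a - (snd z - of_int b)"], simp)
  qed auto
qed

lemma lozenges_eq: "lozenges = range tile_set"
proof
  show "lozenges \<subseteq> range tile_set"
    unfolding lozenges_def basic_lozenges_def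
    using lozenge_Col_odd lozenge_Col_even lozenge_Hor by fastforce
  show "range tile_set \<subseteq> lozenges"
  proof
    fix A assume "A \<in> range tile_set"
    then obtain d where A: "A = tile_set d" by blast
    have "\<exists>a b B. A = (\<lambda>v. v + (of_int a, of_int b)) ` B \<and> B \<in> basic_lozenges"
    proof (cases d)
      case (Col a i)
      then show ?thesis
        using A lozenge_Col_odd lozenge_Col_even unfolding basic_lozenges_def
        by (cases i rule: int_parity_cases) blast+
    next
      case (Hor a b)
      then show ?thesis using A lozenge_Hor unfolding basic_lozenges_def by blast
    qed
    then show "A \<in> lozenges" unfolding lozenges_def by blast
  qed
qed

text \<open>This is the passage from geometry to combinatorics: interiors are disjoint exactly when no triangle
is shared, and a region is covered exactly when each of its triangles is.\<close>

lemma lozenge_tiling_iff: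
  "lozenge_tiling (\<Union>(cell ` C)) (tile_set ` D) \<longleftrightarrow> discrete_tiling C D"
proof -
  have pw: "pairwise (\<lambda>A B. interior A \<inter> interior B = {}) (tile_set ` D)
      \<longleftrightarrow> (\<forall>d\<in>D. \<forall>d'\<in>D. d \<noteq> d' \<longrightarrow> cells d \<inter> cells d' = {})"
    using inj_eq[OF tile_set_inj] by (auto simp: pairwise_def interiors_disjoint_iff)
  have inc: "(\<forall>A\<in>tile_set ` D. A \<subseteq> \<Union>(cell ` C)) \<longleftrightarrow> (\<forall>d\<in>D. cells d \<subseteq> C)"
    by (simp add: tile_set_subset_iff del: UN_iff Union_iff)
  have disc: "discrete_tiling C D \<longleftrightarrow> (\<forall>d\<in>D. cells d \<subseteq> C) \<and>
      (\<forall>d\<in>D. \<forall>d'\<in>D. d \<noteq> d' \<longrightarrow> cells d \<inter> cells d' = {}) \<and> (\<forall>t\<in>C. \<exists>d\<in>D. t \<in> cells d)"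
    (is "_ \<longleftrightarrow> ?sub \<and> ?disj \<and> ?cov")
  proof
    assume dt: "discrete_tiling C D"
    then have sub: ?sub and ex1: "\<And>t. t \<in> C \<Longrightarrow> \<exists>!d. d \<in> D \<and> t \<in> cells d"
      by (simp_all add: discrete_tiling_def)
    have "d = d'" if "d \<in> D" "d' \<in> D" "t \<in> cells d" "t \<in> cells d'" for d d' t
      using ex1[of t] sub that by blast
    then have ?disj by blast
    moreover have ?cov using ex1 by blast
    ultimately show "?sub \<and> ?disj \<and> ?cov" using sub by blast
  next
    assume rhs: "?sub \<and> ?disj \<and> ?cov"
    have "\<exists>!d. d \<in> D \<and> t \<in> cells d" if t: "t \<in> C" for t
    proof -
      obtain d where d: "d \<in> D" "t \<in> cells d" using rhs t by blast
      have "d' = d" if "d' \<in> D" "t \<in> cells d'" for d' using rhs d that by blast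
      then show ?thesis using d by blast
    qed
    then show "discrete_tiling C D" using rhs by (simp add: discrete_tiling_def)
  qed
  show ?thesis
  proof (cases "\<forall>d\<in>D. cells d \<subseteq> C")
    case True
    have cov: "\<Union>(tile_set ` D) = \<Union>(cell ` C) \<longleftrightarrow> (\<forall>t\<in>C. \<exists>d\<in>D. t \<in> cells d)"
      by (rule Union_tile_sets_iff) (use True in blast)
    have rng: "tile_set ` D \<subseteq> lozenges" unfolding lozenges_eq by (rule image_mono) simp
    show ?thesis
      unfolding lozenge_tiling_def disc pw inc cov using rng by (simp only: simp_thms)
  next
    case False
    then show ?thesis unfolding lozenge_tiling_def disc pw inc by (simp only: simp_thms)
  qed
qed

theorem num_tilings_Union_cells:
  "num_tilings (\<Union>(cell ` C)) = card {D. discrete_tiling C D}"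
proof -
  have "{T. lozenge_tiling (\<Union>(cell ` C)) T} = (`) tile_set ` {D. discrete_tiling C D}"
  proof (intro Set.set_eqI iffI)
    fix T assume T: "T \<in> {T. lozenge_tiling (\<Union>(cell ` C)) T}"
    then have "T \<subseteq> range tile_set" by (simp add: lozenge_tiling_def lozenges_eq)
    then obtain D where "T = tile_set ` D" by (blast elim: subset_imageE)
    then show "T \<in> (`) tile_set ` {D. discrete_tiling C D}" using T lozenge_tiling_iff by auto
  qed (auto simp: lozenge_tiling_iff)
  moreover have "inj ((`) tile_set)"
    using inj_image_eq_iff[OF tile_set_inj] by (auto intro: injI)
  ultimately show ?thesis
    unfolding num_tilings_def by (simp add: card_image inj_on_subset)
qed

section \<open>The hexagons as unions of cells\<close>

lemma convex_contains_line_piece: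
  fixes H :: "(real \<times> real) set"
  assumes H: "convex H" and p: "(x0, m * x0 + c) \<in> H" and q: "(x1, m * x1 + c) \<in> H" and x: "x0 \<le> x" "x \<le> x1"
  shows "(x, m * x + c) \<in> H"
proof (cases "x0 = x1")
  case False
  then have less: "x0 < x1" using x by linarith
  define t where "t = (x - x0) / (x1 - x0)"
  have t: "0 \<le> t" "t \<le> 1" using less x by (simp_all add: t_def)
  have "t * (x1 - x0) = x - x0" using less by (simp add: t_def)
  then have xt: "x = (1 - t) * x0 + t * x1" by (simp add: algebra_simps)
  have "(1 - t) *\<^sub>R (x0, m * x0 + c) + t *\<^sub>R (x1, m * x1 + c) \<in> H"
    using t by (intro convexD[OF H] p q) auto
  moreover have "(1 - t) *\<^sub>R (x0, m * x0 + c) + t *\<^sub>R (x1, m * x1 + c) = (x, m * x + c)"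
    unfolding xt by (simp add: algebra_simps)
  ultimately show ?thesis by simp
qed (use p x in simp)

lemma convex_contains_vertical_piece:
  fixes H :: "(real \<times> real) set"
  assumes H: "convex H" and p: "(x, y0) \<in> H" and q: "(x, y1) \<in> H" and y: "y0 \<le> y" "y \<le> y1"
  shows "(x, y) \<in> H"
proof (cases "y0 = y1")
  case False
  then have less: "y0 < y1" using y by linarith
  define t where "t = (y - y0) / (y1 - y0)"
  have t: "0 \<le> t" "t \<le> 1" using less y by (simp_all add: t_def)
  have "t * (y1 - y0) = y - y0" using less by (simp add: t_def)
  then have yt: "y = (1 - t) * y0 + t * y1" by (simp add: algebra_simps)
  have "(1 - t) *\<^sub>R (x, y0) + t *\<^sub>R (x, y1) \<in> H"
    using t by (intro convexD[OF H] p q) auto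
  moreover have "(1 - t) *\<^sub>R (x, y0) + t *\<^sub>R (x, y1) = (x, y)"
    unfolding yt by (simp add: algebra_simps)
  ultimately show ?thesis by simp
qed (use p y in simp)

text \<open>A point between the lower and the upper boundary lies on a vertical segment whose end points lie on
edges of the hexagon.\<close>

lemma hexagon_eq:
  assumes "0 < M" "0 < N" "M < L"
  shows "hexagon L M N = {(x, y). 0 \<le> x \<and> x \<le> of_int L \<and> 0 \<le> y \<and> x - of_int (L - M) \<le> y \<and>
    y \<le> x + of_int N \<and> y \<le> of_int (M + N)}" (is "_ = ?S")
proof
  have "?S = {z. inner (-1, 0) z \<le> 0} \<inter> {z. inner (1, 0) z \<le> of_int L} \<inter> {z. inner (0, -1) z \<le> 0}
     \<inter> {z. inner (1, -1) z \<le> of_int (L - M)} \<inter> {z. inner (-1, 1) z \<le> of_int N} \<inter> {z. inner (0, 1) z \<le> of_int (M + N)}"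
    by auto
  then have "convex ?S" by (simp only:) (intro convex_Int convex_halfspace_le)
  then show "hexagon L M N \<subseteq> ?S"
    unfolding hexagon_def by (rule hull_minimal[rotated]) (use assms in auto)
next
  show "?S \<subseteq> hexagon L M N"
  proof
    fix z assume z: "z \<in> ?S"
    obtain x y where zz: "z = (x, y)" by (cases z)
    let ?H = "hexagon L M N"
    have cv: "convex ?H" unfolding hexagon_def by (rule convex_convex_hull)
    have corners: "(0, 0) \<in> ?H" "(of_int (L - M), 0) \<in> ?H" "(of_int L, of_int M) \<in> ?H"
      "(of_int L, of_int (M + N)) \<in> ?H" "(of_int M, of_int (M + N)) \<in> ?H" "(0, of_int N) \<in> ?H"
      unfolding hexagon_def by (auto intro: hull_inc)
    have low: "(x, max 0 (x - of_int (L - M))) \<in> ?H"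
    proof (cases "x \<le> of_int (L - M)")
      case True
      then show ?thesis
        using convex_contains_line_piece[OF cv, of 0 0 0 "of_int (L - M)" x] corners z by (simp add: zz)
    next
      case False
      then show ?thesis
        using convex_contains_line_piece[OF cv, of "of_int (L - M)" 1 "- of_int (L - M)" "of_int L" x] corners z
        by (simp add: zz algebra_simps)
    qed
    have high: "(x, min (x + of_int N) (of_int (M + N))) \<in> ?H"
    proof (cases "x \<le> of_int M")
      case True
      then show ?thesis
        using convex_contains_line_piece[OF cv, of 0 1 "of_int N" "of_int M" x] corners z by (simp add: zz)
    next
      case False
      then show ?thesis
        using convex_contains_line_piece[OF cv, of "of_int M" 0 "of_int (M + N)" "of_int L" x] corners z
        by (simp add: zz)
    qed
    show "z \<in> ?H"
      unfolding zz by (rule convex_contains_vertical_piece[OF cv low high]) (use z in \<open>auto simp: zz\<close>)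
  qed
qed

text \<open>The region between two lattice paths. In column \<open>a\<close> the path with heights \<open>lo a\<close> and \<open>lo (a + 1)\<close>
runs along the separator with index \<open>lo a + lo (a + 1)\<close>, whether it is horizontal or diagonal there.\<close>

definition strip :: "int \<Rightarrow> (int \<Rightarrow> int) \<Rightarrow> (int \<Rightarrow> int) \<Rightarrow> (int \<times> int) set" where
  "strip L lo hi = {(a, i). 0 \<le> a \<and> a < L \<and> lo a + lo (a + 1) \<le> i \<and> i < hi a + hi (a + 1)}"

definition lower_height :: "int \<Rightarrow> int \<Rightarrow> int \<Rightarrow> int" where
  "lower_height L M a = max 0 (a - (L - M))"

text \<open>The upper boundary of the reduced hexagon at integer abscissae; between them it is linear because no kink
occurs there.\<close>

definition upper_height :: "int \<Rightarrow> int \<Rightarrow> int \<Rightarrow> int \<Rightarrow> int \<Rightarrow> int" where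
  "upper_height M N r k a = min (min (a + N) (M + N)) (max k (a + k - r))"

text \<open>The pointwise minimum or maximum of two lattice paths is a lattice path, and it commutes with the
passage from heights to separator indices.\<close>

lemma min_add_max_add_steps:
  fixes p q :: int
  assumes "p' = p \<or> p' = p + 1" "q' = q \<or> q' = q + 1"
  shows "min p q + min p' q' = min (p + p') (q + q')" "max p q + max p' q' = max (p + p') (q + q')"
  using assms by (auto simp: min_def max_def)

text \<open>The bounds on \<open>k\<close> keep the upper boundary above the lower one throughout, so that each column really
contains triangles and the region has no one-dimensional parts.\<close>

lemma reduced_hexagon_eq_cells:
  assumes "0 < M" "0 < N" "M < L" "N \<le> k" "N - L + M + r \<le> k"
  shows "reduced_hexagon L M N r k = \<Union>(cell ` strip L (lower_height L M) (upper_height M N r k))"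
proof -
  let ?lo = "lower_height L M" and ?hi = "upper_height M N r k"
  have lo: "?lo a + ?lo (a + 1) = max (2 * 0) (2 * (a - (L - M)) + 1)" for a
    by (simp add: lower_height_def max_def)
  have hi: "?hi a + ?hi (a + 1)
      = min (min (2 * (a + N) + 1) (2 * (M + N))) (max (2 * k) (2 * (a + k - r) + 1))" for a
  proof -
    have mx: "max k (a + k - r) + max k (a + 1 + k - r) = max (k + k) ((a + k - r) + (a + 1 + k - r))"
      by (rule min_add_max_add_steps) auto
    have mn: "min (a + N) (M + N) + min (a + 1 + N) (M + N) = min ((a + N) + (a + 1 + N)) ((M + N) + (M + N))"
      by (rule min_add_max_add_steps) auto
    have "?hi a + ?hi (a + 1) = min (min (a + N) (M + N) + min (a + 1 + N) (M + N))
        (max k (a + k - r) + max k (a + 1 + k - r))"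
      unfolding upper_height_def by (rule min_add_max_add_steps) (auto simp: min_def max_def)
    then show ?thesis unfolding mx mn by (simp add: algebra_simps)
  qed
  have S: "sep a (2 * (a - (L - M)) + 1) x = x - of_int (L - M)" "sep a (2 * (a + N) + 1) x = x + of_int N"
      "sep a (2 * (a + k - r) + 1) x = x + of_int k - of_int r" for a x
    unfolding sep_odd by simp_all
  show ?thesis
  proof (intro Set.set_eqI iffI)
    fix z assume z: "z \<in> reduced_hexagon L M N r k"
    obtain x y where zz: "z = (x, y)" by (cases z)
    have xy: "0 \<le> x" "x \<le> of_int L" "0 \<le> y" "x - of_int (L - M) \<le> y" "y \<le> x + of_int N" "y \<le> of_int (M + N)"
      "y \<le> max (of_int k) (x + of_int k - of_int r)"
      using z unfolding reduced_hexagon_def hexagon_eq[OF assms(1-3)] zz by auto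
    obtain a where a: "0 \<le> a" "a < L" "of_int a \<le> x" "x \<le> of_int a + 1"
    proof (cases "x = of_int L")
      case True
      then show ?thesis using that[of "L - 1"] assms by auto
    next
      case False
      then have "\<lfloor>x\<rfloor> < L" using xy by (simp add: floor_less_iff)
      then show ?thesis using that[of "\<lfloor>x\<rfloor>"] xy by linarith
    qed
    have "?lo a + ?lo (a + 1) < ?hi a + ?hi (a + 1)"
      unfolding lo hi using assms a by (auto simp: max_def min_def)
    moreover have "sep a (?lo a + ?lo (a + 1)) x \<le> y"
      unfolding lo using xy S(1)[of a x] sep_even[of a 0 x] by (auto simp: max_def)
    moreover have "y \<le> sep a (?hi a + ?hi (a + 1)) x"
    proof -
      have "y \<le> sep a (max (2 * k) (2 * (a + k - r) + 1)) x"
      proof (cases "y \<le> of_int k")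
        case True
        then have "y \<le> sep a (2 * k) x" by (simp add: sep_even)
        then show ?thesis
          using sep_mono[OF a(3,4), of "2 * k" "max (2 * k) (2 * (a + k - r) + 1)"] by linarith
      next
        case False
        then have "y \<le> sep a (2 * (a + k - r) + 1) x" unfolding S using xy(7) by linarith
        then show ?thesis
          using sep_mono[OF a(3,4), of "2 * (a + k - r) + 1" "max (2 * k) (2 * (a + k - r) + 1)"] by linarith
      qed
      moreover have "y \<le> sep a (2 * (a + N) + 1) x" unfolding S using xy by simp
      moreover have "y \<le> sep a (2 * (M + N)) x" using xy by (simp only: sep_even)
      ultimately show ?thesis unfolding hi by (simp add: min_def)
    qed
    ultimately obtain i where "?lo a + ?lo (a + 1) \<le> i" "i < ?hi a + ?hi (a + 1)" "sep a i x \<le> y" "y \<le> sep a (i + 1) x"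
      using sep_between by blast
    then have "(a, i) \<in> strip L ?lo ?hi" "z \<in> cell (a, i)"
      using a by (auto simp: strip_def cell_def zz)
    then show "z \<in> \<Union>(cell ` strip L ?lo ?hi)" by blast
  next
    fix z assume "z \<in> \<Union>(cell ` strip L ?lo ?hi)"
    then obtain a i where ai: "(a, i) \<in> strip L ?lo ?hi" and z: "z \<in> cell (a, i)" by auto
    obtain x y where zz: "z = (x, y)" by (cases z)
    have x: "of_int a \<le> x" "x \<le> of_int a + 1" and y: "sep a i x \<le> y" "y \<le> sep a (i + 1) x"
      using z by (auto simp: cell_def zz)
    have i: "2 * 0 \<le> i" "2 * (a - (L - M)) + 1 \<le> i" "i + 1 \<le> 2 * (a + N) + 1" "i + 1 \<le> 2 * (M + N)"
      "i + 1 \<le> 2 * k \<or> i + 1 \<le> 2 * (a + k - r) + 1" and a: "0 \<le> a" "a < L"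
      using ai unfolding strip_def mem_Collect_eq prod.case lo hi by auto
    note mono = sep_mono[OF x]
    have "0 \<le> y" using mono[OF i(1)] y sep_even[of a 0 x] by simp
    moreover have "x - of_int (L - M) \<le> y" using mono[OF i(2)] y S(1)[of a x] by linarith
    moreover have "y \<le> x + of_int N" using mono[OF i(3)] y S(2)[of a x] by linarith
    moreover have "y \<le> of_int (M + N)" using mono[OF i(4)] y sep_even[of a "M + N" x] by linarith
    moreover have "y \<le> max (of_int k) (x + of_int k - of_int r)"
      using i(5)
    proof
      assume "i + 1 \<le> 2 * k"
      then show ?thesis using mono[of "i + 1" "2 * k"] y sep_even[of a k x] by simp
    next
      assume "i + 1 \<le> 2 * (a + k - r) + 1"
      then show ?thesis using mono[of "i + 1" "2 * (a + k - r) + 1"] y S(3)[of a x] by linarith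
    qed
    moreover have "0 \<le> x" "x \<le> of_int L"
    proof -
      have "(0 :: real) \<le> of_int a" "of_int (a + 1) \<le> (of_int L :: real)" using a by (simp, simp only: of_int_le_iff)
      then show "0 \<le> x" "x \<le> of_int L" using x by auto
    qed
    ultimately show "z \<in> reduced_hexagon L M N r k"
      unfolding reduced_hexagon_def hexagon_eq[OF assms(1-3)] zz by simp
  qed
qed

lemma hexagon_eq_reduced:
  assumes "0 < M" "0 < N" "M < L"
  shows "hexagon L M N = reduced_hexagon L M N r (min (M + N) (r + N))"
proof -
  have "y \<le> max (of_int (min (M + N) (r + N))) (x + of_int (min (M + N) (r + N)) - of_int r)"
    if "(x, y) \<in> hexagon L M N" for x y
    using that unfolding hexagon_eq[OF assms] by (cases "M \<le> r") (auto simp: min_def max_def)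
  then show ?thesis unfolding reduced_hexagon_def by auto
qed

section \<open>Families of nonintersecting paths\<close>

text \<open>One time step, in which the paths with index in \<open>E\<close> move up. Values outside the index range are
\<open>0\<close>, so that families of paths are determined by their relevant values and can be counted.\<close>

definition advance :: "nat \<Rightarrow> nat set \<Rightarrow> (nat \<Rightarrow> nat) \<Rightarrow> nat \<Rightarrow> nat" where
  "advance N E x = (\<lambda>i. if i < N then (if i \<in> E then Suc (x i) else x i) else 0)"

definition admissible :: "nat \<Rightarrow> nat \<Rightarrow> nat \<Rightarrow> nat \<Rightarrow> (nat \<Rightarrow> nat) \<Rightarrow> bool" where
  "admissible N r k a x \<longleftrightarrow> strict_mono_on {..<N} x \<and> (a = r \<longrightarrow> (\<forall>i<N. x i < k))"

text \<open>Families of \<open>N\<close> nonintersecting paths up to time \<open>m\<close> that start at heights \<open>0, ..., N - 1\<close> and lie below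
\<open>k\<close> at time \<open>r\<close>, when that time is reached.\<close>

definition path_families :: "nat \<Rightarrow> nat \<Rightarrow> nat \<Rightarrow> nat \<Rightarrow> (nat \<Rightarrow> nat \<Rightarrow> nat) set" where
  "path_families N r k m = {h.
     (\<forall>i<N. h 0 i = i) \<and>
     (\<forall>a<m. \<forall>i<N. h (Suc a) i = h a i \<or> h (Suc a) i = Suc (h a i)) \<and>
     (\<forall>a\<le>m. admissible N r k a (h a)) \<and>
     (\<forall>a i. m < a \<or> N \<le> i \<longrightarrow> h a i = 0)}"

lemma path_families_0:
  assumes "0 < r"
  shows "path_families N r k 0 = {\<lambda>a i. if a = 0 \<and> i < N then i else 0}"
  using assms
  by (auto simp: path_families_def admissible_def fun_eq_iff strict_mono_on_def)

lemma path_families_Suc_decompose: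
  assumes "h \<in> path_families N r k (Suc m)"
  defines "E \<equiv> {i. i < N \<and> h (Suc m) i \<noteq> h m i}"
  shows "h(Suc m := (\<lambda>_. 0)) \<in> path_families N r k m" "h (Suc m) = advance N E (h m)"
proof -
  show "h(Suc m := (\<lambda>_. 0)) \<in> path_families N r k m"
    using assms(1) by (auto simp: path_families_def)
  show "h (Suc m) = advance N E (h m)"
  proof
    fix i
    have "h (Suc m) i = h m i \<or> h (Suc m) i = Suc (h m i)" if "i < N"
      using assms(1) that by (simp add: path_families_def)
    moreover have "h (Suc m) i = 0" if "N \<le> i"
      using assms(1) that by (simp add: path_families_def)
    ultimately show "h (Suc m) i = advance N E (h m) i"
      by (cases "i < N") (auto simp: advance_def E_def)
  qed
qed

lemma path_families_extend:
  assumes "h \<in> path_families N r k m" "admissible N r k (Suc m) (advance N E (h m))"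
  shows "h(Suc m := advance N E (h m)) \<in> path_families N r k (Suc m)"
proof -
  let ?g = "h(Suc m := advance N E (h m))"
  have "?g (Suc a) i = ?g a i \<or> ?g (Suc a) i = Suc (?g a i)" if "a < Suc m" "i < N" for a i
    using assms(1) that by (cases "a = m") (auto simp: path_families_def advance_def)
  moreover have "admissible N r k a (?g a)" if "a \<le> Suc m" for a
    using assms that by (cases "a = Suc m") (auto simp: path_families_def)
  moreover have "?g a i = 0" if "Suc m < a \<or> N \<le> i" for a i
    using assms(1) that by (cases "a = Suc m") (auto simp: path_families_def advance_def)
  moreover have "?g 0 i = i" if "i < N" for i
    using assms(1) that by (auto simp: path_families_def)
  ultimately show ?thesis unfolding path_families_def by blast
qed

lemma finite_path_families:
  assumes "0 < r"
  shows "finite (path_families N r k m)"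
proof (induction m)
  case 0
  then show ?case by (simp add: path_families_0[OF assms])
next
  case (Suc m)
  have "path_families N r k (Suc m)
      \<subseteq> (\<lambda>(h, E). h(Suc m := advance N E (h m))) ` (path_families N r k m \<times> Pow {..<N})"
  proof
    fix h assume h: "h \<in> path_families N r k (Suc m)"
    define E where "E = {i. i < N \<and> h (Suc m) i \<noteq> h m i}"
    define g where "g = h(Suc m := (\<lambda>_. 0))"
    have g: "g \<in> path_families N r k m" and "h (Suc m) = advance N E (h m)"
      using path_families_Suc_decompose[OF h] unfolding E_def g_def by auto
    then have "h = g(Suc m := advance N E (g m))"
      by (auto simp: g_def fun_eq_iff)
    moreover have "E \<in> Pow {..<N}" by (auto simp: E_def)
    ultimately show "h \<in> (\<lambda>(h, E). h(Suc m := advance N E (h m))) ` (path_families N r k m \<times> Pow {..<N})"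
      using g by force
  qed
  then show ?case by (rule finite_subset) (use Suc in auto)
qed

text \<open>A family up to time \<open>m + 1\<close> is a family up to time \<open>m\<close> with one admissible step.\<close>

lemma sum_path_families_Suc:
  fixes f :: "(nat \<Rightarrow> nat) \<Rightarrow> 'a::comm_monoid_add"
  assumes "0 < r"
  shows "(\<Sum>h\<in>path_families N r k (Suc m). f (h (Suc m)))
    = (\<Sum>h\<in>path_families N r k m.
         \<Sum>E | E \<subseteq> {..<N} \<and> admissible N r k (Suc m) (advance N E (h m)). f (advance N E (h m)))"
proof -
  define A where "A h = {E. E \<subseteq> {..<N} \<and> admissible N r k (Suc m) (advance N E (h m))}"
    for h :: "nat \<Rightarrow> nat \<Rightarrow> nat"
  have fin: "finite (A h)" for h
    unfolding A_def by (rule finite_subset[of _ "Pow {..<N}"]) auto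
  have "(\<Sum>h\<in>path_families N r k (Suc m). f (h (Suc m)))
      = (\<Sum>(h, E)\<in>Sigma (path_families N r k m) A. f (advance N E (h m)))"
  proof (rule sum.reindex_bij_witness[of _ "\<lambda>(h, E). h(Suc m := advance N E (h m))"
        "\<lambda>h. (h(Suc m := (\<lambda>_. 0)), {i. i < N \<and> h (Suc m) i \<noteq> h m i})"])
    fix h assume h: "h \<in> path_families N r k (Suc m)"
    define E where "E = {i. i < N \<and> h (Suc m) i \<noteq> h m i}"
    note dec = path_families_Suc_decompose[OF h, folded E_def]
    have E: "{i. i < N \<and> h (Suc m) i \<noteq> h m i} = E" by (rule E_def[symmetric])
    show "(case (h(Suc m := (\<lambda>_. 0)), {i. i < N \<and> h (Suc m) i \<noteq> h m i}) of
        (h, E) \<Rightarrow> h(Suc m := advance N E (h m))) = h"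
      unfolding E prod.case by (simp add: dec(2)[symmetric])
    have "admissible N r k (Suc m) (h (Suc m))"
      using h by (simp add: path_families_def)
    then have "admissible N r k (Suc m) (advance N E (h m))" unfolding dec(2) .
    moreover have "E \<subseteq> {..<N}" by (auto simp: E_def)
    ultimately have "E \<in> A h" by (simp add: A_def)
    moreover have "A (h(Suc m := (\<lambda>_. 0))) = A h" by (simp add: A_def)
    ultimately show "(h(Suc m := (\<lambda>_. 0)), {i. i < N \<and> h (Suc m) i \<noteq> h m i}) \<in> Sigma (path_families N r k m) A"
      unfolding E using dec(1) by blast
    show "(case (h(Suc m := (\<lambda>_. 0)), {i. i < N \<and> h (Suc m) i \<noteq> h m i}) of
        (h, E) \<Rightarrow> f (advance N E (h m))) = f (h (Suc m))"
      unfolding E prod.case by (simp add: dec(2)[symmetric])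
  next
    fix hE assume hE: "hE \<in> Sigma (path_families N r k m) A"
    obtain h E where [simp]: "hE = (h, E)" by (cases hE)
    have h: "h \<in> path_families N r k m" and E: "E \<subseteq> {..<N}"
      and ad: "admissible N r k (Suc m) (advance N E (h m))"
      using hE by (auto simp: A_def)
    have "h (Suc m) = (\<lambda>_. 0)" using h by (auto simp: path_families_def)
    then show "((case hE of (h, E) \<Rightarrow> h(Suc m := advance N E (h m)))(Suc m := (\<lambda>_. 0)),
        {i. i < N \<and> (case hE of (h, E) \<Rightarrow> h(Suc m := advance N E (h m))) (Suc m) i \<noteq>
          (case hE of (h, E) \<Rightarrow> h(Suc m := advance N E (h m))) m i}) = hE"
      using E by (auto simp: advance_def fun_eq_iff)
    show "(case hE of (h, E) \<Rightarrow> h(Suc m := advance N E (h m))) \<in> path_families N r k (Suc m)"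
      using path_families_extend[OF h ad] by simp
  qed
  also have "\<dots> = (\<Sum>h\<in>path_families N r k m. \<Sum>E\<in>A h. f (advance N E (h m)))"
    using fin finite_path_families[OF assms] by (subst sum.Sigma) auto
  finally show ?thesis by (simp add: A_def)
qed

lemma path_families_upper:
  assumes "h \<in> path_families N r k m" "i < N" "a \<le> m"
  shows "h a i \<le> i + a"
  using assms(3)
proof (induction a)
  case 0
  then show ?case using assms by (auto simp: path_families_def)
next
  case (Suc a)
  then have "h (Suc a) i = h a i \<or> h (Suc a) i = Suc (h a i)"
    using assms by (auto simp: path_families_def)
  then show ?case using Suc by auto
qed

lemma path_families_mono:
  assumes "h \<in> path_families N r k m" "i < N" "a \<le> b" "b \<le> m"
  shows "h a i \<le> h b i \<and> h b i \<le> h a i + (b - a)"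
  using assms(3,4)
proof (induction b rule: dec_induct)
  case base
  then show ?case by simp
next
  case (step b)
  then have "h (Suc b) i = h b i \<or> h (Suc b) i = Suc (h b i)"
    using assms by (auto simp: path_families_def)
  then show ?case using step by auto
qed

text \<open>Before the step the heights are distinct integers in increasing order and none moves by more than one,
so two paths cannot swap without meeting.\<close>

lemma advance_collision:
  assumes "strict_mono_on {..<N} x" "\<not> strict_mono_on {..<N} (advance N E x)"
  shows "\<exists>i j. i < j \<and> j < N \<and> advance N E x i = advance N E x j"
proof -
  from assms(2) obtain i j where ij: "i < j" "j < N" "\<not> advance N E x i < advance N E x j"
    unfolding strict_mono_on_def by auto
  then have "x i < x j" using assms(1) unfolding strict_mono_on_def by auto
  then have "advance N E x i = advance N E x j"
    using ij by (auto simp: advance_def split: if_splits)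
  with ij show ?thesis by blast
qed

lemma strict_mono_on_fill_interval:
  fixes y :: "nat \<Rightarrow> nat"
  assumes sm: "strict_mono_on {..<N} y" and y: "\<And>i. i < N \<Longrightarrow> M \<le> y i \<and> y i < M + N" and i: "i < N"
  shows "y i = M + i"
proof -
  have step: "y i + d \<le> y (i + d)" if "i + d < N" for i d
    using that
  proof (induction d)
    case (Suc d)
    then have "y (i + d) < y (i + Suc d)" using sm unfolding strict_mono_on_def by auto
    then show ?case using Suc by auto
  qed simp
  have "y 0 + i \<le> y i" using step[of 0 i] i by simp
  moreover have "y i + (N - 1 - i) \<le> y (N - 1)" using step[of i "N - 1 - i"] i by simp
  moreover have "M \<le> y 0" "y (N - 1) < M + N" using y i by auto
  ultimately show ?thesis using i by linarith
qed

definition full_path_families :: "nat \<Rightarrow> nat \<Rightarrow> nat \<Rightarrow> nat \<Rightarrow> nat \<Rightarrow> (nat \<Rightarrow> nat \<Rightarrow> nat) set" where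
  "full_path_families L M N r k = {h \<in> path_families N r k L. \<forall>i<N. h L i = M + i}"

text \<open>All paths run in parallel: they stay level for the first \<open>L - M\<close> steps and then rise at every step, which
makes them as low as possible at time \<open>r\<close>.\<close>

lemma full_path_families_nonempty:
  assumes "M < L" "r < L" "N \<le> k" "M + N + r \<le> L + k"
  shows "full_path_families L M N r k \<noteq> {}"
proof -
  define h where "h = (\<lambda>a i. if a \<le> L \<and> i < N then i + (a - (L - M)) else 0)"
  have "h \<in> full_path_families L M N r k"
    using assms
    by (auto simp: h_def full_path_families_def path_families_def admissible_def strict_mono_on_def)
  then show ?thesis by blast
qed

section \<open>Tilings of a strip as families of paths\<close>

lemma even_cell_in_cells:
  "(a, 2 * b) \<in> cells d \<longleftrightarrow> d = Col a (2 * b) \<or> d = Col a (2 * b - 1) \<or> d = Hor a b"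
  by (cases d) (auto, presburger+)

lemma odd_cell_in_cells:
  "(a, 2 * b + 1) \<in> cells d \<longleftrightarrow> d = Col a (2 * b + 1) \<or> d = Col a (2 * b) \<or> d = Hor (a - 1) b"
  by (cases d) (auto, presburger+)

lemma discrete_tiling_unique:
  assumes "discrete_tiling C D" "d \<in> D" "d' \<in> D" "t \<in> cells d" "t \<in> cells d'"
  shows "d = d'"
  using assms unfolding discrete_tiling_def by blast

lemma discrete_tiling_subset_eq:
  assumes D: "discrete_tiling C D" and D': "discrete_tiling C D'" and sub: "D' \<subseteq> D"
  shows "D' = D"
proof
  show "D \<subseteq> D'"
  proof
    fix d assume d: "d \<in> D"
    obtain t where t: "t \<in> cells d" by (cases d) auto
    then have "t \<in> C" using D d unfolding discrete_tiling_def by blast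
    then obtain d' where "d' \<in> D'" "t \<in> cells d'" using D' unfolding discrete_tiling_def by blast
    then show "d \<in> D'" using discrete_tiling_unique[OF D d _ t] sub by blast
  qed
qed (rule sub)

text \<open>Reads a path off a tiling: from height \<open>b\<close> at abscissa \<open>a\<close> it follows the lozenge on the right of the
vertical edge from \<open>(a, b)\<close> to \<open>(a, b + 1)\<close>, which is \<open>Col a (2 * b + 1)\<close> when the path goes up and
\<open>Col a (2 * b)\<close> when it stays level.\<close>

primrec climb :: "tile set \<Rightarrow> nat \<Rightarrow> nat \<Rightarrow> nat" where
  "climb D 0 i = i"
| "climb D (Suc a) i = climb D a i + (if Col (int a) (2 * int (climb D a i) + 1) \<in> D then 1 else 0)"

text \<open>A region between two lattice paths that has \<open>N\<close> vertical edges on its left side and \<open>N\<close> on its right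
side.\<close>

locale lattice_strip =
  fixes L M N :: nat and lo hi :: "int \<Rightarrow> int"
  assumes lo_step: "\<And>a. lo a \<le> lo (a + 1) \<and> lo (a + 1) \<le> lo a + 1"
    and hi_step: "\<And>a. hi a \<le> hi (a + 1) \<and> hi (a + 1) \<le> hi a + 1"
    and left_end: "lo 0 = 0" "hi 0 = int N" and right_end: "lo (int L) = int M" "hi (int L) = int (M + N)"
begin

definition families :: "(nat \<Rightarrow> nat \<Rightarrow> nat) set" where
  "families = {h.
     (\<forall>i<N. h 0 i = i) \<and> (\<forall>i<N. h L i = M + i) \<and>
     (\<forall>a<L. \<forall>i<N. h (Suc a) i = h a i \<or> h (Suc a) i = Suc (h a i)) \<and>
     (\<forall>a\<le>L. strict_mono_on {..<N} (h a)) \<and>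
     (\<forall>a\<le>L. \<forall>i<N. lo (int a) \<le> int (h a i) \<and> int (h a i) < hi (int a)) \<and>
     (\<forall>a i. L < a \<or> N \<le> i \<longrightarrow> h a i = 0)}"

abbreviation S :: "(int \<times> int) set" where
  "S \<equiv> strip (int L) lo hi"

text \<open>A step of a path from height \<open>b\<close> to height \<open>b'\<close> in column \<open>a\<close> uses the lozenge \<open>Col a (b + b')\<close>, and each
interior vertical edge that no path crosses is covered by a lozenge of type \<open>Hor\<close>.\<close>

definition tiles_of :: "(nat \<Rightarrow> nat \<Rightarrow> nat) \<Rightarrow> tile set" where
  "tiles_of h = {Col (int a) (int (h a i) + int (h (Suc a) i)) | a i. a < L \<and> i < N} \<union>
     {Hor (int a) b | a b. Suc a < L \<and> lo (int (Suc a)) \<le> b \<and> b < hi (int (Suc a)) \<and>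
        b \<notin> (\<lambda>i. int (h (Suc a) i)) ` {..<N}}"

lemma Col_in_tiles_of:
  "Col x y \<in> tiles_of h \<longleftrightarrow> (\<exists>a i. x = int a \<and> y = int (h a i) + int (h (Suc a) i) \<and> a < L \<and> i < N)"
  by (auto simp: tiles_of_def)

lemma Hor_in_tiles_of:
  "Hor x b \<in> tiles_of h \<longleftrightarrow> (\<exists>a. x = int a \<and> Suc a < L \<and> lo (int (Suc a)) \<le> b \<and> b < hi (int (Suc a)) \<and>
     b \<notin> (\<lambda>i. int (h (Suc a) i)) ` {..<N})"
  by (auto simp: tiles_of_def)

text \<open>The triangles with even index are those with a right vertical side. Such a triangle lies in the strip
exactly if its vertical side does; likewise for odd indices and left sides.\<close>

lemma even_in_strip:
  assumes "a < L"
  shows "(int a, 2 * b) \<in> S \<longleftrightarrow> lo (int (Suc a)) \<le> b \<and> b < hi (int (Suc a))"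
  using assms lo_step[of "int a"] hi_step[of "int a"] by (auto simp: strip_def add.commute)

lemma odd_in_strip:
  assumes "a < L"
  shows "(int a, 2 * b + 1) \<in> S \<longleftrightarrow> lo (int a) \<le> b \<and> b < hi (int a)"
  using assms lo_step[of "int a"] hi_step[of "int a"] by (auto simp: strip_def add.commute)

lemma strip_cases:
  assumes "t \<in> S"
  obtains a b where "a < L" "t = (int a, 2 * b)" "lo (int (Suc a)) \<le> b" "b < hi (int (Suc a))"
  | a b where "a < L" "t = (int a, 2 * b + 1)" "lo (int a) \<le> b" "b < hi (int a)"
proof -
  obtain x i where t: "t = (x, i)" by (cases t)
  then have "0 \<le> x" "x < int L" using assms by (auto simp: strip_def)
  then obtain a where a: "x = int a" "a < L" by (metis nat_0_le of_nat_less_iff)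
  show thesis
  proof (cases i rule: int_parity_cases)
    case (1 b)
    then show thesis using that(1)[of a b] a t assms even_in_strip[of a b] by simp
  next
    case (2 b)
    then show thesis using that(2)[of a b] a t assms odd_in_strip[of a b] by simp
  qed
qed

lemma families_inj:
  assumes "h \<in> families" "a \<le> L" "i < N" "j < N" "h a i = h a j"
  shows "i = j"
proof -
  have "strict_mono_on {..<N} (h a)" using assms by (simp add: families_def)
  then show ?thesis
    using assms(3-5) by (metis lessThan_iff linorder_neqE_nat nat_less_le strict_mono_on_def)
qed

text \<open>There are \<open>N\<close> vertical edges on the right side of the region, so all of them are ends of paths and the
last column needs no lozenge that would stick out of the region.\<close>

lemma families_right_full:
  assumes h: "h \<in> families" and b: "lo (int L) \<le> b" "b < hi (int L)"
  shows "b \<in> (\<lambda>i. int (h L i)) ` {..<N}"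
proof (rule image_eqI[of _ _ "nat b - M"])
  show "nat b - M \<in> {..<N}" using b right_end by auto
  then have "h L (nat b - M) = M + (nat b - M)" using h by (auto simp: families_def)
  then show "b = int (h L (nat b - M))" using b right_end by auto
qed

lemma families_left_full:
  assumes h: "h \<in> families" and b: "lo 0 \<le> b" "b < hi 0"
  shows "b \<in> (\<lambda>i. int (h 0 i)) ` {..<N}"
proof (rule image_eqI[of _ _ "nat b"])
  show "nat b \<in> {..<N}" using b left_end by auto
  then have "h 0 (nat b) = nat b" using h by (auto simp: families_def)
  then show "b = int (h 0 (nat b))" using b left_end by auto
qed

text \<open>A triangle has one vertical side. If a path crosses this side, the triangle belongs to the lozenge of that
path and to no other, since the paths are disjoint; otherwise it belongs to the lozenge that
covers the side.\<close>

lemma discrete_tiling_tiles_of: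
  assumes h: "h \<in> families"
  shows "discrete_tiling S (tiles_of h)"
proof -
  have step: "h (Suc a) i = h a i \<or> h (Suc a) i = Suc (h a i)" if "a < L" "i < N" for a i
    using h that by (simp add: families_def)
  have bounds: "lo (int a) \<le> int (h a i)" "int (h a i) < hi (int a)" if "a \<le> L" "i < N" for a i
    using h that by (simp_all add: families_def)
  have "cells d \<subseteq> S" if d: "d \<in> tiles_of h" for d
  proof (cases d)
    case (Col x y)
    then obtain a i where ai: "x = int a" "y = int (h a i) + int (h (Suc a) i)" "a < L" "i < N"
      using d Col_in_tiles_of by blast
    have odd: "(int a, 2 * int (h a i) + 1) \<in> S" using odd_in_strip bounds[of a i] ai by simp
    have even: "(int a, 2 * int (h (Suc a) i)) \<in> S" using even_in_strip bounds[of "Suc a" i] ai by simp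
    show ?thesis
      using step[OF ai(3,4)]
    proof
      assume "h (Suc a) i = h a i"
      then show ?thesis using odd even by (simp add: Col ai)
    next
      assume "h (Suc a) i = Suc (h a i)"
      then show ?thesis using odd even by (simp add: Col ai algebra_simps)
    qed
  next
    case (Hor x b)
    then obtain a where a: "x = int a" "Suc a < L" "lo (int (Suc a)) \<le> b" "b < hi (int (Suc a))"
      using d Hor_in_tiles_of by blast
    then show ?thesis
      using even_in_strip[of a b] odd_in_strip[of "Suc a" b] by (simp add: Hor add.commute)
  qed
  moreover have "\<exists>!d. d \<in> tiles_of h \<and> t \<in> cells d" if "t \<in> S" for t
    using that
  proof (cases rule: strip_cases)
    case (1 a b)
    have Col_end: "\<exists>i<N. y = int (h a i) + int (h (Suc a) i) \<and> int (h (Suc a) i) = b"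
      if y: "Col (int a) y \<in> tiles_of h" "y = 2 * b \<or> y = 2 * b - 1" for y
    proof -
      obtain i where i: "i < N" "y = int (h a i) + int (h (Suc a) i)"
        using y(1) by (auto simp: Col_in_tiles_of)
      then have "int (h (Suc a) i) = b" using step[OF 1(1) i(1)] y(2) by (auto; presburger)
      then show ?thesis using i by blast
    qed
    show ?thesis
    proof (cases "b \<in> (\<lambda>i. int (h (Suc a) i)) ` {..<N}")
      case True
      then obtain i where i: "i < N" "b = int (h (Suc a) i)" by auto
      define y where "y = int (h a i) + int (h (Suc a) i)"
      have y: "y = 2 * b \<or> y = 2 * b - 1" using step[OF 1(1) i(1)] i by (auto simp: y_def)
      show ?thesis
      proof (rule ex1I[of _ "Col (int a) y"])
        show "Col (int a) y \<in> tiles_of h \<and> t \<in> cells (Col (int a) y)"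
          using y 1 i by (auto simp: Col_in_tiles_of y_def even_cell_in_cells)
      next
        fix d assume d: "d \<in> tiles_of h \<and> t \<in> cells d"
        then consider y' where "d = Col (int a) y'" "y' = 2 * b \<or> y' = 2 * b - 1" | "d = Hor (int a) b"
          unfolding 1 even_cell_in_cells by blast
        then show "d = Col (int a) y"
        proof cases
          case (1 y')
          then obtain j where j: "j < N" "y' = int (h a j) + int (h (Suc a) j)" "int (h (Suc a) j) = b"
            using Col_end[of y'] d by blast
          then have "j = i" using families_inj[OF h, of "Suc a" j i] i \<open>a < L\<close> by simp
          then show ?thesis using 1 j by (simp add: y_def)
        next
          case 2
          then show ?thesis using d True by (auto simp: Hor_in_tiles_of)
        qed
      qed
    next
      case False
      have "Suc a \<noteq> L"
      proof
        assume "Suc a = L"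
        then show False using False families_right_full[OF h] 1 by auto
      qed
      then have Hor: "Hor (int a) b \<in> tiles_of h" using 1 False by (auto simp: Hor_in_tiles_of)
      show ?thesis
      proof (rule ex1I[of _ "Hor (int a) b"])
        show "Hor (int a) b \<in> tiles_of h \<and> t \<in> cells (Hor (int a) b)" using Hor 1 by simp
      next
        fix d assume d: "d \<in> tiles_of h \<and> t \<in> cells d"
        then consider y' where "d = Col (int a) y'" "y' = 2 * b \<or> y' = 2 * b - 1" | "d = Hor (int a) b"
          unfolding 1 even_cell_in_cells by blast
        then show "d = Hor (int a) b"
        proof cases
          case (1 y')
          then show ?thesis using Col_end[of y'] d False by blast
        qed
      qed
    qed
  next
    case (2 a b)
    have Col_start: "\<exists>i<N. y = int (h a i) + int (h (Suc a) i) \<and> int (h a i) = b"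
      if y: "Col (int a) y \<in> tiles_of h" "y = 2 * b + 1 \<or> y = 2 * b" for y
    proof -
      obtain i where i: "i < N" "y = int (h a i) + int (h (Suc a) i)"
        using y(1) by (auto simp: Col_in_tiles_of)
      then have "int (h a i) = b" using step[OF 2(1) i(1)] y(2) by (auto; presburger)
      then show ?thesis using i by blast
    qed
    show ?thesis
    proof (cases "b \<in> (\<lambda>i. int (h a i)) ` {..<N}")
      case True
      then obtain i where i: "i < N" "b = int (h a i)" by auto
      define y where "y = int (h a i) + int (h (Suc a) i)"
      have y: "y = 2 * b + 1 \<or> y = 2 * b" using step[OF 2(1) i(1)] i by (auto simp: y_def)
      show ?thesis
      proof (rule ex1I[of _ "Col (int a) y"])
        show "Col (int a) y \<in> tiles_of h \<and> t \<in> cells (Col (int a) y)"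
          using y 2 i by (auto simp: Col_in_tiles_of y_def odd_cell_in_cells)
      next
        fix d assume d: "d \<in> tiles_of h \<and> t \<in> cells d"
        then consider y' where "d = Col (int a) y'" "y' = 2 * b + 1 \<or> y' = 2 * b" | "d = Hor (int a - 1) b"
          unfolding 2 odd_cell_in_cells by blast
        then show "d = Col (int a) y"
        proof cases
          case (1 y')
          then obtain j where j: "j < N" "y' = int (h a j) + int (h (Suc a) j)" "int (h a j) = b"
            using Col_start[of y'] d by blast
          then have "j = i" using families_inj[OF h, of a j i] i \<open>a < L\<close> by simp
          then show ?thesis using 1 j by (simp add: y_def)
        next
          case 2
          then obtain c where "int a - 1 = int c" "b \<notin> (\<lambda>i. int (h (Suc c) i)) ` {..<N}"
            using d Hor_in_tiles_of by blast
          moreover from this have "a = Suc c" by linarith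
          ultimately show ?thesis using True by blast
        qed
      qed
    next
      case False
      have "a \<noteq> 0"
      proof
        assume "a = 0"
        then show False using False families_left_full[OF h] 2 by auto
      qed
      then obtain c where c: "a = Suc c" by (cases a) auto
      have Hor: "Hor (int c) b \<in> tiles_of h" using 2 False c by (auto simp: Hor_in_tiles_of)
      show ?thesis
      proof (rule ex1I[of _ "Hor (int c) b"])
        show "Hor (int c) b \<in> tiles_of h \<and> t \<in> cells (Hor (int c) b)" using Hor 2 c by simp
      next
        fix d assume d: "d \<in> tiles_of h \<and> t \<in> cells d"
        then consider y' where "d = Col (int a) y'" "y' = 2 * b + 1 \<or> y' = 2 * b" | "d = Hor (int a - 1) b"
          unfolding 2 odd_cell_in_cells by blast
        then show "d = Hor (int c) b"
        proof cases
          case (1 y')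
          then show ?thesis using Col_start[of y'] d False by blast
        qed (simp add: c)
      qed
    qed
  qed
  ultimately show ?thesis by (simp add: discrete_tiling_def)
qed

text \<open>The sum of the heights before and after a step determines both, as they differ by at most one; so the
paths can be read off column by column.\<close>

lemma tiles_of_inj: "inj_on tiles_of families"
proof (rule inj_onI)
  fix h h' assume h: "h \<in> families" and h': "h' \<in> families" and eq: "tiles_of h = tiles_of h'"
  have step: "g (Suc a) i = g a i \<or> g (Suc a) i = Suc (g a i)"
    if "g \<in> families" "a < L" "i < N" for g :: "nat \<Rightarrow> nat \<Rightarrow> nat" and a i
    using that by (simp add: families_def)
  have agree: "\<forall>i<N. h a i = h' a i" if "a \<le> L" for a
    using that
  proof (induction a)
    case 0
    then show ?case using h h' by (simp add: families_def)
  next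
    case (Suc a)
    show ?case
    proof (intro allI impI)
      fix i assume i: "i < N"
      have "Col (int a) (int (h a i) + int (h (Suc a) i)) \<in> tiles_of h'"
        unfolding eq[symmetric] using Suc.prems i by (auto simp: Col_in_tiles_of)
      then obtain j where j: "j < N" "int (h a i) + int (h (Suc a) i) = int (h' a j) + int (h' (Suc a) j)"
        unfolding Col_in_tiles_of by auto
      have "h a i = h' a j"
        using j(2) step[OF h, of a i] step[OF h', of a j] Suc.prems i j(1) by (auto; presburger)
      moreover have "h a j = h' a j" using Suc j(1) by simp
      ultimately have "i = j" using families_inj[OF h, of a i j] Suc.prems i j(1) by simp
      then show "h (Suc a) i = h' (Suc a) i" using j(2) \<open>h a i = h' a j\<close> by simp
    qed
  qed
  show "h = h'"
  proof (intro ext)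
    fix a i
    show "h a i = h' a i"
    proof (cases "a \<le> L \<and> i < N")
      case True
      then show ?thesis using agree by blast
    next
      case False
      then show ?thesis using h h' by (auto simp: families_def not_le)
    qed
  qed
qed

definition vertical_edges :: "tile set \<Rightarrow> nat \<Rightarrow> int set" where
  "vertical_edges D a = {b. lo (int a) \<le> b \<and> b < hi (int a) \<and> Hor (int a - 1) b \<notin> D}"

lemma tiling_Col:
  assumes D: "discrete_tiling S D" and a: "a < L" and b: "b \<in> vertical_edges D a"
  shows "Col (int a) (2 * b + 1) \<in> D \<or> Col (int a) (2 * b) \<in> D"
proof -
  have "(int a, 2 * b + 1) \<in> S" using a b by (simp add: odd_in_strip vertical_edges_def)
  then obtain d where "d \<in> D" "(int a, 2 * b + 1) \<in> cells d"
    using D unfolding discrete_tiling_def by blast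
  then show ?thesis using b by (auto simp: odd_cell_in_cells vertical_edges_def)
qed

lemma tiling_Col_end:
  assumes D: "discrete_tiling S D" and a: "a < L" and d: "d \<in> D" "(int a, 2 * b) \<in> cells d" "d \<noteq> Hor (int a) b"
  shows "b \<in> vertical_edges D (Suc a)"
proof -
  have "(int a, 2 * b) \<in> S" using D d unfolding discrete_tiling_def by blast
  moreover have "Hor (int a) b \<notin> D"
    using discrete_tiling_unique[OF D d(1) _ d(2), of "Hor (int a) b"] d(3) by auto
  ultimately show ?thesis using a by (simp add: even_in_strip vertical_edges_def)
qed

lemma tiling_Col_start:
  assumes D: "discrete_tiling S D" and a: "a < L" and d: "d \<in> D" "(int a, 2 * b + 1) \<in> cells d" "d \<noteq> Hor (int a - 1) b"
  shows "b \<in> vertical_edges D a"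
proof -
  have "(int a, 2 * b + 1) \<in> S" using D d unfolding discrete_tiling_def by blast
  moreover have "Hor (int a - 1) b \<notin> D"
    using discrete_tiling_unique[OF D d(1) _ d(2), of "Hor (int a - 1) b"] d(3) by auto
  ultimately show ?thesis using a by (simp add: odd_in_strip vertical_edges_def)
qed

lemma climb_Suc_Col:
  assumes D: "discrete_tiling S D" and a: "a < L" and i: "int (climb D a i) \<in> vertical_edges D a"
  shows "Col (int a) (int (climb D a i) + int (climb D (Suc a) i)) \<in> D"
  using tiling_Col[OF D a i] by (auto simp: algebra_simps)

text \<open>At every abscissa the paths occupy exactly the vertical edges that are not inside a lozenge. Passing
through a column is a bijection between such edges on its two sides, because both adjacent triangles
must be covered within the column.\<close>

lemma climb_vertical_edges:
  assumes D: "discrete_tiling S D" and "a \<le> L"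
  shows "vertical_edges D a = (\<lambda>i. int (climb D a i)) ` {..<N} \<and> strict_mono_on {..<N} (climb D a)"
  using assms(2)
proof (induction a)
  case 0
  \<comment> \<open>No lozenge reaches beyond the left side, so all its edges are crossed.\<close>
  have "Hor (- 1) b \<notin> D" for b
    using D unfolding discrete_tiling_def by (fastforce simp: strip_def)
  then have "vertical_edges D 0 = {0..<int N}" by (auto simp: vertical_edges_def left_end)
  also have "\<dots> = int ` {..<N}" by (simp add: image_int_atLeastLessThan lessThan_atLeast0)
  finally show ?case by (simp add: strict_mono_on_def)
next
  case (Suc a)
  then have a: "a < L" and edges: "vertical_edges D a = (\<lambda>i. int (climb D a i)) ` {..<N}"
    and sm: "strict_mono_on {..<N} (climb D a)" by auto
  have step: "climb D (Suc a) i = climb D a i \<or> climb D (Suc a) i = Suc (climb D a i)" for i by simp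
  have col: "Col (int a) (int (climb D a i) + int (climb D (Suc a) i)) \<in> D" if "i < N" for i
    using climb_Suc_Col[OF D a] edges that by blast
  have "vertical_edges D (Suc a) = (\<lambda>i. int (climb D (Suc a) i)) ` {..<N}"
  proof (intro Set.set_eqI iffI)
    fix b assume b: "b \<in> vertical_edges D (Suc a)"
    then have "(int a, 2 * b) \<in> S" using a by (simp add: even_in_strip vertical_edges_def)
    then obtain d where d: "d \<in> D" "(int a, 2 * b) \<in> cells d"
      using D unfolding discrete_tiling_def by blast
    have "d \<noteq> Hor (int a) b" using b d(1) by (auto simp: vertical_edges_def)
    then consider "d = Col (int a) (2 * b)" | "d = Col (int a) (2 * b - 1)"
      using d(2) even_cell_in_cells by blast
    then show "b \<in> (\<lambda>i. int (climb D (Suc a) i)) ` {..<N}"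
    proof cases
      case 1
      then have "b \<in> vertical_edges D a" by (intro tiling_Col_start[OF D a d(1)]) auto
      then obtain i where i: "i < N" "b = int (climb D a i)" using edges by auto
      have "Col (int a) (2 * b + 1) \<notin> D"
        using discrete_tiling_unique[OF D d(1), of "Col (int a) (2 * b + 1)" "(int a, 2 * b + 1)"] 1 by auto
      then have "b = int (climb D (Suc a) i)" using i by simp
      then show ?thesis using i(1) by blast
    next
      case 2
      then have "b - 1 \<in> vertical_edges D a"
        by (intro tiling_Col_start[OF D a d(1)]) (auto simp: algebra_simps)
      then obtain i where i: "i < N" "b - 1 = int (climb D a i)" using edges by auto
      then have y: "2 * int (climb D a i) + 1 = 2 * b - 1" by linarith
      have "Col (int a) (2 * int (climb D a i) + 1) \<in> D" unfolding y using 2 d(1) by simp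
      then have "int (climb D (Suc a) i) = int (climb D a i) + 1" by simp
      then have "b = int (climb D (Suc a) i)" using i by simp
      then show ?thesis using i(1) by blast
    qed
  next
    fix b assume "b \<in> (\<lambda>i. int (climb D (Suc a) i)) ` {..<N}"
    then obtain i where i: "i < N" "b = int (climb D (Suc a) i)" by auto
    have "int (climb D a i) + b = 2 * b \<or> int (climb D a i) + b = 2 * b - 1"
      using step[of i] i(2) by linarith
    then have "(int a, 2 * b) \<in> cells (Col (int a) (int (climb D a i) + b))"
      unfolding even_cell_in_cells tile.inject by blast
    then show "b \<in> vertical_edges D (Suc a)"
      using col[OF i(1)] unfolding i(2)[symmetric] by (intro tiling_Col_end[OF D a]) auto
  qed
  moreover have "strict_mono_on {..<N} (climb D (Suc a))"
  proof (rule strict_mono_onI)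
    fix i j assume ij: "i \<in> {..<N}" "j \<in> {..<N}" "i < j"
    then have lt: "climb D a i < climb D a j" using sm by (simp add: strict_mono_on_def)
    show "climb D (Suc a) i < climb D (Suc a) j"
    proof (rule ccontr)
      assume "\<not> climb D (Suc a) i < climb D (Suc a) j"
      then have eqs: "climb D (Suc a) i = Suc (climb D a i)" "climb D (Suc a) j = climb D a j"
        "climb D a j = Suc (climb D a i)"
        using step[of i] step[of j] lt by linarith+
      have y: "int (climb D a i) + int (climb D (Suc a) i) = 2 * int (climb D a j) - 1"
        "int (climb D a j) + int (climb D (Suc a) j) = 2 * int (climb D a j)"
        using eqs by linarith+
      have "Col (int a) (2 * int (climb D a j) - 1) \<in> D" "Col (int a) (2 * int (climb D a j)) \<in> D"
        using col[of i] col[of j] ij unfolding y by auto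
      then show False
        using discrete_tiling_unique[OF D, of "Col (int a) (2 * int (climb D a j) - 1)"
          "Col (int a) (2 * int (climb D a j))" "(int a, 2 * int (climb D a j))"]
        by (simp add: even_cell_in_cells)
    qed
  qed
  ultimately show ?case by blast
qed

text \<open>The lozenges of the paths and those over the uncrossed edges all belong to the tiling. Since they form a
tiling themselves, they are all of it.\<close>

lemma tiling_from_family:
  assumes D: "discrete_tiling S D"
  shows "D \<in> tiles_of ` families"
proof -
  \<comment> \<open>The truncation makes the family vanish outside its range, as counting requires.\<close>
  define h where "h = (\<lambda>a i. if a \<le> L \<and> i < N then climb D a i else 0)"
  note inv = climb_vertical_edges[OF D]
  have edges: "vertical_edges D a = (\<lambda>i. int (h a i)) ` {..<N}" if "a \<le> L" for a
    using inv[OF that] that by (auto simp: h_def)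
  have sm: "strict_mono_on {..<N} (h a)" if "a \<le> L" for a
    using inv[OF that] that by (auto simp: h_def strict_mono_on_def)
  have bounds: "lo (int a) \<le> int (h a i)" "int (h a i) < hi (int a)" if "a \<le> L" "i < N" for a i
    using edges[OF that(1)] that(2) by (auto simp: vertical_edges_def)
  have "h \<in> families"
  proof -
    have "h L i = M + i" if "i < N" for i
    proof (rule strict_mono_on_fill_interval[OF sm[OF order_refl] _ that])
      fix i assume "i < N"
      then show "M \<le> h L i \<and> h L i < M + N" using bounds[of L i] by (simp add: right_end)
    qed
    moreover have "h (Suc a) i = h a i \<or> h (Suc a) i = Suc (h a i)" if "a < L" "i < N" for a i
      using that by (simp add: h_def)
    ultimately show ?thesis
      using sm bounds unfolding families_def by (simp add: h_def)
  qed
  moreover have "tiles_of h \<subseteq> D"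
  proof
    fix d assume d: "d \<in> tiles_of h"
    show "d \<in> D"
    proof (cases d)
      case (Col x y)
      then obtain a i where ai: "x = int a" "y = int (h a i) + int (h (Suc a) i)" "a < L" "i < N"
        using d Col_in_tiles_of by blast
      have "int (climb D a i) \<in> vertical_edges D a" using inv[of a] ai by auto
      from climb_Suc_Col[OF D ai(3) this] show ?thesis using ai by (simp add: Col h_def)
    next
      case (Hor x b)
      then obtain a where a: "x = int a" "Suc a < L" "lo (int (Suc a)) \<le> b" "b < hi (int (Suc a))"
        "b \<notin> (\<lambda>i. int (h (Suc a) i)) ` {..<N}"
        using d Hor_in_tiles_of by blast
      then have "b \<notin> vertical_edges D (Suc a)" using edges[of "Suc a"] by simp
      then show ?thesis using a by (simp add: vertical_edges_def Hor)
    qed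
  qed
  ultimately show ?thesis
    using discrete_tiling_subset_eq[OF D discrete_tiling_tiles_of] by blast
qed

theorem card_discrete_tilings: "card {D. discrete_tiling S D} = card families"
proof -
  have "{D. discrete_tiling S D} = tiles_of ` families"
    using tiling_from_family discrete_tiling_tiles_of by blast
  then show ?thesis by (simp add: card_image[OF tiles_of_inj])
qed

end

text \<open>Only the condition at time \<open>r\<close> has to be imposed: the other bounds follow from the end points of the paths
and from the fact that they rise by zero or one in each step.\<close>

lemma num_tilings_reduced_hexagon:
  fixes L M N r k :: nat
  assumes "0 < M" "0 < N" "M < L" "0 < r" "r < L" "N \<le> k" "M + N + r \<le> L + k"
    "k \<le> M + N" "k \<le> N + r"
  shows "num_tilings (reduced_hexagon (int L) (int M) (int N) (int r) (int k))
    = card (full_path_families L M N r k)"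
proof -
  let ?lo = "lower_height (int L) (int M)" and ?hi = "upper_height (int M) (int N) (int r) (int k)"
  interpret lattice_strip L M N ?lo ?hi
  proof
    show "?lo a \<le> ?lo (a + 1) \<and> ?lo (a + 1) \<le> ?lo a + 1" for a
      by (auto simp: lower_height_def max_def)
    show "?hi a \<le> ?hi (a + 1) \<and> ?hi (a + 1) \<le> ?hi a + 1" for a
      unfolding upper_height_def by linarith
    show "?lo 0 = 0" "?hi 0 = int N" "?lo (int L) = int M" "?hi (int L) = int (M + N)"
      using assms unfolding lower_height_def upper_height_def by linarith+
  qed
  have "families = full_path_families L M N r k"
  proof (intro Set.set_eqI iffI)
    fix h assume h: "h \<in> families"
    then have "int (h r i) < int k" if "i < N" for i
    proof -
      have "int (h r i) < ?hi (int r)" using h that assms by (simp add: families_def)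
      then show ?thesis by (simp add: upper_height_def)
    qed
    then show "h \<in> full_path_families L M N r k"
      using h by (simp add: families_def full_path_families_def path_families_def admissible_def)
  next
    fix h assume h: "h \<in> full_path_families L M N r k"
    then have pf: "h \<in> path_families N r k L" and hend: "\<forall>i<N. h L i = M + i"
      by (auto simp: full_path_families_def)
    have adm: "admissible N r k a (h a)" if "a \<le> L" for a
      using pf that by (simp add: path_families_def)
    have "?lo (int a) \<le> int (h a i) \<and> int (h a i) < ?hi (int a)" if a: "a \<le> L" and i: "i < N" for a i
    proof -
      have start: "h a i \<le> i + a" by (rule path_families_upper[OF pf i a])
      have last: "h a i \<le> M + i" "M + i \<le> h a i + (L - a)"
        using path_families_mono[OF pf i a order_refl] hend i by auto
      have hr: "h r i < k" using adm[of r] assms i by (simp add: admissible_def)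
      have "h a i < k \<or> int (h a i) < int a + int k - int r"
      proof (cases "a \<le> r")
        case True
        then show ?thesis using path_families_mono[OF pf i True] assms hr by auto
      next
        case False
        then show ?thesis using path_families_mono[OF pf i, of r a] a hr by auto
      qed
      then show ?thesis
        using start last a i unfolding lower_height_def upper_height_def by (auto simp: max_def min_def)
    qed
    then show "h \<in> families"
      using pf hend adm by (simp add: families_def path_families_def admissible_def)
  qed
  moreover have "reduced_hexagon (int L) (int M) (int N) (int r) (int k) = \<Union>(cell ` S)"
    by (rule reduced_hexagon_eq_cells) (use assms in auto)
  ultimately show ?thesis
    using card_discrete_tilings by (simp only: num_tilings_Union_cells)
qed

section \<open>Determinants of polynomials\<close>

text \<open>The determinant of the coordinate matrix of \<open>n\<close> polynomials of degree less than \<open>n\<close> in the monomial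
basis; coefficients of higher degree are cut off.\<close>

definition poly_det :: "nat \<Rightarrow> (nat \<Rightarrow> complex poly) \<Rightarrow> complex" where
  "poly_det n F = Determinant.det (Matrix.mat n n (\<lambda>(i, t). coeff (F i) t))"

lemma poly_det_cong:
  assumes "\<And>i. i < n \<Longrightarrow> F i = G i"
  shows "poly_det n F = poly_det n G"
proof -
  have "Matrix.mat n n (\<lambda>(i, t). coeff (F i) t) = Matrix.mat n n (\<lambda>(i, t). coeff (G i) t)"
    by (rule eq_matI) (auto simp: assms)
  then show ?thesis by (simp add: poly_det_def)
qed

lemma poly_det_leibniz:
  "poly_det n F = (\<Sum>p | p permutes {0..<n}. signof p * (\<Prod>i = 0..<n. coeff (F i) (p i)))"
  unfolding poly_det_def
  by (subst det_def'[of _ n]) (auto intro!: sum.cong prod.cong dest: permutes_in_image)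

lemma poly_det_add:
  assumes "k < n"
  shows "poly_det n (F(k := u + v)) = poly_det n (F(k := u)) + poly_det n (F(k := v))"
proof -
  have split: "(\<Prod>i = 0..<n. coeff ((F(k := w)) i) (p i))
      = coeff w (p k) * (\<Prod>i\<in>{0..<n} - {k}. coeff (F i) (p i))" for w and p :: "nat \<Rightarrow> nat"
    using assms by (subst prod.remove[of _ k]) (auto intro!: prod.cong)
  show ?thesis
    unfolding poly_det_leibniz split by (simp add: algebra_simps sum.distrib)
qed

lemma poly_det_equal_rows:
  assumes "i < n" "j < n" "i \<noteq> j" "F i = F j"
  shows "poly_det n F = 0"
  unfolding poly_det_def
  by (rule det_identical_rows[of _ n i j]) (use assms in \<open>auto intro!: eq_vecI\<close>)

lemma poly_det_monic:
  assumes "\<And>i. i < n \<Longrightarrow> degree (F i) = i \<and> lead_coeff (F i) = 1"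
  shows "poly_det n F = 1"
proof -
  let ?A = "Matrix.mat n n (\<lambda>(i, t). coeff (F i) t)"
  have "Determinant.det ?A = prod_list (diag_mat ?A)"
    by (rule det_lower_triangular[of n]) (use assms in \<open>auto intro!: coeff_eq_0\<close>)
  also have "diag_mat ?A = map (\<lambda>i. 1) [0..<n]"
    unfolding diag_mat_def using assms by (auto intro!: map_cong) (metis)
  finally show ?thesis by (simp add: poly_det_def map_replicate_const)
qed

text \<open>Expansion of a product of sums: each row in \<open>K\<close> chooses one of its two summands.\<close>

lemma poly_det_subset_expansion:
  assumes "finite K" "K \<subseteq> {..<n}"
  shows "poly_det n (\<lambda>i. if i \<in> K then u i + v i else F i)
    = (\<Sum>E\<in>Pow K. poly_det n (\<lambda>i. if i \<in> E then v i else if i \<in> K then u i else F i))"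
  using assms
proof (induction K arbitrary: F rule: finite_induct)
  case empty
  then show ?case by simp
next
  case (insert k K)
  define G where "G E = (\<lambda>i. if i \<in> E then v i else if i \<in> K then u i else F i)" for E
  have k: "k < n" and kK: "k \<notin> K" using insert by auto
  have upd: "(\<lambda>i. if i \<in> E then v i else if i \<in> K then u i else (F(k := w)) i) = (G E)(k := w)"
    if "E \<in> Pow K" for E w
    using that kK by (auto simp: G_def fun_eq_iff)
  have eq: "(\<lambda>i. if i \<in> insert k K then u i + v i else F i)
      = (\<lambda>i. if i \<in> K then u i + v i else (F(k := u k + v k)) i)"
    using kK by (auto simp: fun_eq_iff)
  have "poly_det n (\<lambda>i. if i \<in> insert k K then u i + v i else F i)
      = (\<Sum>E\<in>Pow K. poly_det n ((G E)(k := u k + v k)))"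
    unfolding eq using insert.IH[of "F(k := u k + v k)"] insert.prems by (simp add: upd)
  also have "\<dots> = (\<Sum>E\<in>Pow K. poly_det n ((G E)(k := u k)))
      + (\<Sum>E\<in>Pow K. poly_det n ((G E)(k := v k)))"
    by (simp add: poly_det_add[OF k] sum.distrib)
  also have "(\<Sum>E\<in>Pow K. poly_det n ((G E)(k := u k)))
      = (\<Sum>E\<in>Pow K. poly_det n (\<lambda>i. if i \<in> E then v i else if i \<in> insert k K then u i else F i))"
    using kK by (intro sum.cong refl arg_cong[of _ _ "poly_det n"]) (auto simp: G_def fun_eq_iff)
  also have "(\<Sum>E\<in>Pow K. poly_det n ((G E)(k := v k)))
      = (\<Sum>E\<in>insert k ` Pow K. poly_det n (\<lambda>i. if i \<in> E then v i else if i \<in> insert k K then u i else F i))"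
    using kK
    by (subst sum.reindex)
       (auto simp: inj_on_def G_def fun_eq_iff intro!: sum.cong arg_cong[of _ _ "poly_det n"])
  also have "(\<Sum>E\<in>Pow K. poly_det n (\<lambda>i. if i \<in> E then v i else if i \<in> insert k K then u i else F i)) + \<dots>
      = (\<Sum>E\<in>Pow (insert k K). poly_det n (\<lambda>i. if i \<in> E then v i else if i \<in> insert k K then u i else F i))"
    using kK insert.hyps unfolding Pow_insert by (subst sum.union_disjoint) auto
  finally show ?case .
qed

lemma poly_det_mat_col:
  "poly_det n F = Determinant.det (Matrix.mat n n (\<lambda>(t, i). coeff (F i) t))"
proof -
  have "Matrix.mat n n (\<lambda>(t, i). coeff (F i) t) = transpose_mat (Matrix.mat n n (\<lambda>(i, t). coeff (F i) t))"
    by (rule eq_matI) auto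
  then show ?thesis
    by (simp add: poly_det_def det_transpose[of _ n])
qed

lemma poly_det_cramer:
  assumes k: "k < n" and g: "g = (\<Sum>i<n. Polynomial.smult (v i) (F i))"
  shows "poly_det n (F(k := g)) = v k * poly_det n F"
proof -
  let ?A = "Matrix.mat n n (\<lambda>(t, i). coeff (F i) t)"
  have "replace_col ?A (?A *\<^sub>v Matrix.vec n v) k = Matrix.mat n n (\<lambda>(t, i). coeff ((F(k := g)) i) t)"
    by (rule eq_matI)
       (auto simp: replace_col_def g scalar_prod_def coeff_sum atLeast0LessThan mult.commute intro!: sum.cong)
  then show ?thesis
    using cramer_lemma_mat[of ?A n "Matrix.vec n v" k] k by (simp add: poly_det_mat_col)
qed

text \<open>The coefficients come from the adjugate matrix.\<close>

lemma poly_det_nonzero_spans: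
  assumes det: "poly_det n F \<noteq> 0" and F: "\<And>i. i < n \<Longrightarrow> degree (F i) < n" and g: "degree g < n"
  shows "\<exists>v. g = (\<Sum>i<n. Polynomial.smult (v i) (F i))"
proof -
  define A where "A = Matrix.mat n n (\<lambda>(t, i). coeff (F i) t)"
  define b where "b = Matrix.vec n (coeff g)"
  define x where "x = inverse (poly_det n F) \<cdot>\<^sub>v (adj_mat A *\<^sub>v b)"
  have A: "A \<in> carrier_mat n n" by (simp add: A_def)
  note adj = adj_mat[OF A]
  have b: "b \<in> carrier_vec n" by (simp add: b_def)
  have "A *\<^sub>v (adj_mat A *\<^sub>v b) = (A * adj_mat A) *\<^sub>v b"
    using A adj(1) b by (simp only: assoc_mult_mat_vec[of A n n "adj_mat A" n b])
  also have "\<dots> = poly_det n F \<cdot>\<^sub>v b"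
  proof (rule eq_vecI)
    fix t assume "t < dim_vec (poly_det n F \<cdot>\<^sub>v b)"
    then have t: "t < n" using b by simp
    have "row (Determinant.det A \<cdot>\<^sub>m 1\<^sub>m n) t = Determinant.det A \<cdot>\<^sub>v unit_vec n t"
      using t by (intro eq_vecI) auto
    then show "((A * adj_mat A) *\<^sub>v b) $ t = (poly_det n F \<cdot>\<^sub>v b) $ t"
      using t b adj(2) by (simp add: poly_det_mat_col flip: A_def)
  qed (use b A adj in auto)
  finally have *: "A *\<^sub>v (adj_mat A *\<^sub>v b) = poly_det n F \<cdot>\<^sub>v b" .
  have Ax: "A *\<^sub>v x = b"
    using A adj b det unfolding x_def
    by (subst mult_mat_vec[of _ n n]) (auto simp: * smult_smult_assoc)
  have "g = (\<Sum>i<n. Polynomial.smult (x $ i) (F i))"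
  proof (rule poly_eqI)
    fix t
    show "coeff g t = coeff (\<Sum>i<n. Polynomial.smult (x $ i) (F i)) t"
    proof (cases "t < n")
      case True
      have "coeff g t = (A *\<^sub>v x) $ t" using True by (simp add: Ax b_def)
      also have "\<dots> = (\<Sum>i<n. x $ i * coeff (F i) t)"
        using True A adj b by (auto simp: A_def scalar_prod_def x_def atLeast0LessThan mult.commute intro!: sum.cong)
      finally show ?thesis by (simp add: coeff_sum)
    next
      case False
      have "coeff (F i) t = 0" if "i < n" for i
        using F[OF that] False by (auto intro: coeff_eq_0)
      moreover have "coeff g t = 0" using g False by (auto intro: coeff_eq_0)
      ultimately show ?thesis by (simp add: coeff_sum)
    qed
  qed
  then show ?thesis by blast
qed

section \<open>A determinant that counts path families\<close>

text \<open>The generating polynomial of the end heights of a path that starts at height \<open>x\<close> and has \<open>m\<close> steps left.\<close>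

definition step_pow :: "nat \<Rightarrow> nat \<Rightarrow> complex poly" where
  "step_pow m x = [:1, 1:] ^ m * Polynomial.monom 1 x"

lemma step_pow_0: "step_pow 0 x = Polynomial.monom 1 x"
  by (simp add: step_pow_def)

lemma step_pow_Suc: "step_pow (Suc m) x = step_pow m x + step_pow m (Suc x)"
proof -
  have "[:1, 1:] = (1 :: complex poly) + Polynomial.monom 1 1" by (simp add: monom_Suc one_pCons)
  moreover have "Polynomial.monom 1 (Suc x) = Polynomial.monom 1 1 * (Polynomial.monom 1 x :: complex poly)"
    by (simp add: mult_monom)
  ultimately show ?thesis by (simp add: step_pow_def algebra_simps)
qed

lemma step_pow_monic: "degree (step_pow m x) = m + x" "lead_coeff (step_pow m x) = 1"
proof -
  have "degree (step_pow m x) = degree ([:1, 1:] ^ m :: complex poly) + degree (Polynomial.monom (1 :: complex) x)"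
    unfolding step_pow_def by (rule degree_mult_eq) auto
  then show "degree (step_pow m x) = m + x" by (simp add: degree_power_eq degree_monom_eq)
  show "lead_coeff (step_pow m x) = 1"
    unfolding step_pow_def by (simp add: lead_coeff_mult lead_coeff_power degree_monom_eq)
qed

text \<open>The polynomials that the Hermite-Pade problem combines, with arbitrary polynomials \<open>c\<close> in the place of
the multiples of \<open>(1 + z)\<^sup>L\<close>. They are ordered so that the row with index \<open>i\<close> outside the block of \<open>c\<close> is
monic of degree \<open>i\<close>, which makes the final determinant unitriangular; and going from \<open>j\<close> to \<open>j + 1\<close> changes
only the row with index \<open>L - r + j\<close>.\<close>

definition pade_rows :: "nat \<Rightarrow> nat \<Rightarrow> nat \<Rightarrow> nat \<Rightarrow> nat \<Rightarrow> (nat \<Rightarrow> complex poly) \<Rightarrow> nat \<Rightarrow> complex poly" where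
  "pade_rows L M N r j c i =
     (if M \<le> i \<and> i < M + N then c (i - M)
      else if i < L - r + j then Polynomial.monom 1 i
      else step_pow (L - r) (i - (L - r)))"

definition pade_det :: "nat \<Rightarrow> nat \<Rightarrow> nat \<Rightarrow> nat \<Rightarrow> nat \<Rightarrow> (nat \<Rightarrow> complex poly) \<Rightarrow> complex" where
  "pade_det L M N r j c = poly_det (L + N) (pade_rows L M N r j c)"

lemma pade_det_cong:
  assumes "\<And>i. i < N \<Longrightarrow> c i = d i"
  shows "pade_det L M N r j c = pade_det L M N r j d"
  unfolding pade_det_def by (rule poly_det_cong) (use assms in \<open>auto simp: pade_rows_def\<close>)

text \<open>Multilinearity splits off one factor \<open>1 + z\<close> from each path row, and the choice of a summand in each row is
the choice of the paths that move up.\<close>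

lemma pade_det_step:
  assumes lt: "M < L"
  shows "pade_det L M N r j (\<lambda>i. step_pow (Suc m) (x i))
    = (\<Sum>E\<in>Pow {..<N}. pade_det L M N r j (\<lambda>i. step_pow m (advance N E x i)))"
proof -
  define K where "K = {M..<M + N}"
  define F where "F = pade_rows L M N r j (\<lambda>i. 0)"
  let ?f = "\<lambda>E. poly_det (L + N) (\<lambda>i. if i \<in> E then step_pow m (Suc (x (i - M)))
      else if i \<in> K then step_pow m (x (i - M)) else F i)"
  have "pade_det L M N r j (\<lambda>i. step_pow (Suc m) (x i))
     = poly_det (L + N) (\<lambda>i. if i \<in> K then step_pow m (x (i - M)) + step_pow m (Suc (x (i - M))) else F i)"
    unfolding pade_det_def
    by (rule poly_det_cong) (auto simp: pade_rows_def step_pow_Suc K_def F_def)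
  also have "\<dots> = sum ?f (Pow K)"
    by (rule poly_det_subset_expansion) (use lt in \<open>auto simp: K_def\<close>)
  also have "Pow K = (`) ((+) M) ` Pow {..<N}"
    by (subst image_Pow_surj[of _ "{..<N}" K]) (auto simp: K_def image_add_atLeastLessThan lessThan_atLeast0)
  also have "sum ?f \<dots> = (\<Sum>E\<in>Pow {..<N}. ?f ((+) M ` E))"
    by (subst sum.reindex) (auto simp: inj_on_def inj_image_eq_iff)
  also have "\<dots> = (\<Sum>E\<in>Pow {..<N}. pade_det L M N r j (\<lambda>i. step_pow m (advance N E x i)))"
  proof (rule sum.cong[OF refl])
    fix E assume "E \<in> Pow {..<N}"
    moreover have "i \<in> (+) M ` E \<longleftrightarrow> M \<le> i \<and> i - M \<in> E" for i
      by (auto simp: image_iff intro!: bexI[of _ "i - M"])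
    ultimately show "?f ((+) M ` E) = pade_det L M N r j (\<lambda>i. step_pow m (advance N E x i))"
      unfolding pade_det_def
      by (intro poly_det_cong) (auto simp: pade_rows_def advance_def K_def F_def)
  qed
  finally show ?thesis .
qed

lemma pade_det_collision:
  assumes "M < L" "i < N" "j < N" "i \<noteq> j" "c i = c j"
  shows "pade_det L M N r k c = 0"
  unfolding pade_det_def
  by (rule poly_det_equal_rows[of "M + i" _ "M + j"]) (use assms in \<open>auto simp: pade_rows_def\<close>)

lemma pade_det_row_hit:
  assumes "M < L" "i < N" "t < L + N" "t < M \<or> M + N \<le> t" "c i = pade_rows L M N r k c t"
  shows "pade_det L M N r k c = 0"
  unfolding pade_det_def
  by (rule poly_det_equal_rows[of "M + i" _ t]) (use assms in \<open>auto simp: pade_rows_def\<close>)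

text \<open>The steps that are not admissible contribute zero: colliding paths give two equal rows, and a path that
is too high at time \<open>r\<close> gives a row \<open>(1 + z)\<^sup>L\<^sup>-\<^sup>r z\<^sup>x\<close> with \<open>k \<le> x < N + r\<close>, which is already present.\<close>

lemma pade_det_expand:
  assumes lt: "M < L" and r: "0 < r" "r < L" and k: "M + N + r \<le> L + k" and m: "m \<le> L"
  shows "pade_det L M N r k (\<lambda>i. step_pow L i)
    = (\<Sum>h\<in>path_families N r k m. pade_det L M N r k (\<lambda>i. step_pow (L - m) (h m i)))"
  using m
proof (induction m)
  case 0
  then show ?case
    by (simp add: path_families_0[OF r(1)]) (rule pade_det_cong, simp)
next
  case (Suc m)
  let ?D = "pade_det L M N r k"
  have vanish: "?D (\<lambda>i. step_pow (L - Suc m) (advance N E (h m) i)) = 0"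
    if h: "h \<in> path_families N r k m" and E: "E \<subseteq> {..<N}"
      and na: "\<not> admissible N r k (Suc m) (advance N E (h m))" for h E
  proof (cases "strict_mono_on {..<N} (advance N E (h m))")
    case False
    moreover have "strict_mono_on {..<N} (h m)"
      using h by (auto simp: path_families_def admissible_def)
    ultimately obtain i j where "i < j" "j < N" "advance N E (h m) i = advance N E (h m) j"
      using advance_collision by blast
    then show ?thesis by (intro pade_det_collision[of M L i N j]) (use lt in auto)
  next
    case True
    with na obtain i where rm: "Suc m = r" and i: "i < N" "k \<le> advance N E (h m) i"
      by (auto simp: admissible_def not_less)
    have "h m i \<le> i + m" by (rule path_families_upper[OF h]) (use i in auto)
    then have up: "advance N E (h m) i < N + r" using i rm by (auto simp: advance_def)
    show ?thesis
      by (rule pade_det_row_hit[of M L i N "L - r + advance N E (h m) i"])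
         (use lt i up r k rm in \<open>auto simp: pade_rows_def\<close>)
  qed
  have "?D (\<lambda>i. step_pow L i) = (\<Sum>h\<in>path_families N r k m. ?D (\<lambda>i. step_pow (L - m) (h m i)))"
    using Suc by simp
  also have "\<dots> = (\<Sum>h\<in>path_families N r k m. \<Sum>E\<in>Pow {..<N}.
      ?D (\<lambda>i. step_pow (L - Suc m) (advance N E (h m) i)))"
    using pade_det_step[OF lt, of N r k "L - Suc m"] Suc.prems by (simp add: Suc_diff_Suc)
  also have "\<dots> = (\<Sum>h\<in>path_families N r k m.
      \<Sum>E | E \<subseteq> {..<N} \<and> admissible N r k (Suc m) (advance N E (h m)).
        ?D (\<lambda>i. step_pow (L - Suc m) (advance N E (h m) i)))"
    by (intro sum.cong[OF refl] sum.mono_neutral_right) (auto intro: vanish)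
  also have "\<dots> = (\<Sum>h\<in>path_families N r k (Suc m). ?D (\<lambda>i. step_pow (L - Suc m) (h (Suc m) i)))"
    by (rule sum_path_families_Suc[OF r(1), symmetric, of "\<lambda>x. ?D (\<lambda>i. step_pow (L - Suc m) (x i))"])
  finally show ?case .
qed

lemma pade_det_endpoints:
  assumes "M < L" "r < L" "M + N + r \<le> L + k"
  shows "pade_det L M N r k (\<lambda>i. Polynomial.monom 1 (M + i)) = 1"
  unfolding pade_det_def
proof (rule poly_det_monic)
  fix i
  let ?R = "pade_rows L M N r k (\<lambda>i. Polynomial.monom 1 (M + i)) i"
  show "degree ?R = i \<and> lead_coeff ?R = 1"
  proof (cases "i < L - r + k")
    case True
    then have "?R = Polynomial.monom 1 i" by (simp add: pade_rows_def)
    then show ?thesis by (simp add: degree_monom_eq)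
  next
    case False
    then have "\<not> i < M + N" using assms by linarith
    with False have "?R = step_pow (L - r) (i - (L - r))" by (simp add: pade_rows_def)
    moreover have "L - r + (i - (L - r)) = i" using False by simp
    ultimately have "degree ?R = i" "lead_coeff ?R = 1"
      using step_pow_monic[of "L - r" "i - (L - r)"] by (simp_all only:)
    then show ?thesis by simp
  qed
qed

text \<open>After the last step the path rows are monomials. They have degree less than \<open>L - r + k\<close> because the paths
are below \<open>k\<close> at time \<open>r\<close>, so each of them either has its degree among the target heights or repeats
another row.\<close>

theorem pade_det_eq_card:
  assumes lt: "M < L" and r: "0 < r" "r < L" and k: "M + N + r \<le> L + k" "k \<le> N + r"
  shows "pade_det L M N r k (\<lambda>i. step_pow L i) = of_nat (card (full_path_families L M N r k))"
proof -
  let ?D = "pade_det L M N r k"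
  have summand: "?D (\<lambda>i. step_pow 0 (h L i)) = (if \<forall>i<N. h L i = M + i then 1 else 0)"
    if h: "h \<in> path_families N r k L" for h
  proof (cases "\<forall>i<N. h L i = M + i")
    case True
    then have "?D (\<lambda>i. step_pow 0 (h L i)) = ?D (\<lambda>i. Polynomial.monom 1 (M + i))"
      by (intro pade_det_cong) (simp add: step_pow_0)
    also have "\<dots> = 1" by (rule pade_det_endpoints) (use lt r k in auto)
    finally show ?thesis using True by simp
  next
    case False
    have "strict_mono_on {..<N} (h L)"
      using h by (auto simp: path_families_def admissible_def)
    then obtain i where i: "i < N" "\<not> (M \<le> h L i \<and> h L i < M + N)"
      using False strict_mono_on_fill_interval by blast
    have "admissible N r k r (h r)" using h r by (simp add: path_families_def)
    then have "h r i < k" using i(1) by (simp add: admissible_def)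
    moreover have "h L i \<le> h r i + (L - r)" using path_families_mono[OF h i(1), of r L] r by auto
    ultimately have "h L i < L - r + k" by linarith
    then have "?D (\<lambda>i. step_pow 0 (h L i)) = 0"
      using i lt r k
      by (intro pade_det_row_hit[of M L i N "h L i"]) (auto simp: pade_rows_def step_pow_0)
    then show ?thesis using False by simp
  qed
  have "?D (\<lambda>i. step_pow L i) = (\<Sum>h\<in>path_families N r k L. if \<forall>i<N. h L i = M + i then 1 else 0)"
    using pade_det_expand[OF lt r k(1), of L] summand by simp
  also have "\<dots> = of_nat (card (full_path_families L M N r k))"
    using finite_path_families[OF r(1)]
    by (simp add: full_path_families_def sum.If_cases Int_def)
  finally show ?thesis .
qed

section \<open>The Hermite-Pade problem\<close>

lemma eventually_at_minus_1: "\<forall>\<^sub>F z in at (- 1 :: complex). z + 1 \<noteq> 0"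
proof -
  have "\<forall>\<^sub>F z in at (- 1 :: complex). z \<noteq> - 1" by (simp add: eventually_at_filter)
  then show ?thesis by eventually_elim (simp add: eq_neg_iff_add_eq_0)
qed

text \<open>Both sides say that the order of vanishing at \<open>-1\<close> is at least \<open>n\<close>.\<close>

lemma poly_bigo_iff_dvd:
  fixes F :: "complex poly"
  shows "poly F \<in> O[at (- 1)](\<lambda>z. (z + 1) ^ n) \<longleftrightarrow> [:1, 1:] ^ n dvd F"
proof
  assume "[:1, 1:] ^ n dvd F"
  then obtain s where F: "F = [:1, 1:] ^ n * s" by (elim dvdE)
  have lim: "((\<lambda>z. poly s z) \<longlongrightarrow> poly s (- 1)) (at (- 1))"
    by (intro tendsto_poly tendsto_ident_at)
  have nz: "\<forall>\<^sub>F z in at (- 1 :: complex). (z + 1) ^ n \<noteq> 0"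
    using eventually_at_minus_1 by eventually_elim simp
  have "\<forall>\<^sub>F z in at (- 1). poly s z = poly F z / (z + 1) ^ n"
    using nz by eventually_elim (simp add: F add.commute)
  with lim have "((\<lambda>z. poly F z / (z + 1) ^ n) \<longlongrightarrow> poly s (- 1)) (at (- 1))"
    by (rule Lim_transform_eventually)
  then show "poly F \<in> O[at (- 1)](\<lambda>z. (z + 1) ^ n)"
    using nz by (rule bigoI_tendsto)
next
  assume O: "poly F \<in> O[at (- 1)](\<lambda>z. (z + 1) ^ n)"
  show "[:1, 1:] ^ n dvd F"
  proof (cases "F = 0")
    case False
    define e where "e = order (- 1) F"
    obtain G where F: "F = [:1, 1:] ^ e * G" and G: "\<not> [:1, 1:] dvd G"
      using order_decomp[OF False, of "- 1"] by (auto simp: e_def)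
    have G1: "poly G (- 1) \<noteq> 0" using G by (simp add: poly_eq_0_iff_dvd)
    have "n \<le> e"
    proof (rule ccontr)
      assume "\<not> n \<le> e"
      then have ne: "n = e + (n - e)" "0 < n - e" by auto
      obtain C where C: "\<forall>\<^sub>F z in at (- 1). norm (poly F z) \<le> C * norm ((z + 1) ^ n)"
        using O by (elim landau_o.bigE)
      have bound: "\<forall>\<^sub>F z in at (- 1). norm (poly G z) \<le> C * norm (z + 1) ^ (n - e)"
      proof -
        from C eventually_at_minus_1 show ?thesis
        proof eventually_elim
          case (elim z)
          have "norm (z + 1) ^ e * norm (poly G z) \<le> norm (z + 1) ^ e * (C * norm (z + 1) ^ (n - e))"
            using elim(1) power_add[of "norm (z + 1)" e "n - e"] ne(1)
            by (simp add: F norm_mult norm_power add.commute[of 1] mult.left_commute)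
          then show ?case using elim(2) by (subst (asm) mult_le_cancel_left_pos) auto
        qed
      qed
      have lim_bound: "((\<lambda>z::complex. C * norm (z + 1) ^ (n - e)) \<longlongrightarrow> C * norm (- 1 + 1 :: complex) ^ (n - e)) (at (- 1))"
        by (intro tendsto_intros)
      have lim_G: "((\<lambda>z. norm (poly G z)) \<longlongrightarrow> norm (poly G (- 1))) (at (- 1))"
        by (intro tendsto_intros)
      have "norm (poly G (- 1)) \<le> C * norm (- 1 + 1 :: complex) ^ (n - e)"
        using tendsto_le[OF _ lim_bound lim_G bound] by simp
      then show False using G1 ne(2) by (simp add: power_0_left)
    qed
    then show ?thesis unfolding F by (intro dvd_mult2 le_imp_power_dvd)
  qed simp
qed

lemma sum_lessThan_add:
  fixes f :: "nat \<Rightarrow> 'a::comm_monoid_add"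
  shows "(\<Sum>i<a + b. f i) = (\<Sum>i<a. f i) + (\<Sum>i<b. f (a + i))"
  by (induction b) (simp_all add: add.assoc)

lemma sum_monom_coeff:
  fixes x :: "'a::comm_monoid_add poly"
  assumes "\<And>i. d \<le> i \<Longrightarrow> coeff x i = 0"
  shows "(\<Sum>i<d. Polynomial.monom (coeff x i) i) = x"
  by (rule poly_eqI) (auto simp: coeff_sum assms)

lemma coeff_sum_monom:
  "coeff (\<Sum>i<d. Polynomial.monom (v i) i) t = (if t < d then v t else 0)"
  by (simp add: coeff_sum)

lemma monom_mult_sum_monom:
  fixes v :: "nat \<Rightarrow> 'a::comm_semiring_1"
  shows "Polynomial.monom 1 a * (\<Sum>i<d. Polynomial.monom (v i) i) = (\<Sum>i<d. Polynomial.monom (v i) (a + i))"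
  by (simp add: sum_distrib_left mult_monom)

lemma smult_step_pow: "Polynomial.smult c (step_pow m x) = [:1, 1:] ^ m * Polynomial.monom c x"
  by (simp add: step_pow_def smult_monom flip: mult_smult_right)

locale pade =
  fixes L M N r j :: nat
  assumes M_pos: "0 < M" and N_pos: "0 < N" and M_less: "M < L" and r_pos: "0 < r" and r_less: "r < L"
    and j_lower: "N \<le> j" "M + N + r \<le> L + j" and j_upper: "j < M + N" "j < N + r"
begin

abbreviation rows :: "nat \<Rightarrow> complex poly" where
  "rows \<equiv> pade_rows L M N r j (\<lambda>i. step_pow L i)"

definition P_degree :: nat where "P_degree = L - r + j - (M + N)"

text \<open>The second equation lists the sizes of the four groups of rows.\<close>

lemma row_counts: "M + N + P_degree = L - r + j" "M + (N + (P_degree + (N + r - j))) = L + N"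
  using j_lower j_upper r_less by (auto simp: P_degree_def)

text \<open>The four groups of rows collect the coefficients of \<open>q\<close>, of the quotient of the error term by
\<open>(1 + z)\<^sup>L\<close>, of the lower terms of \<open>P\<close> and of \<open>p\<close>, up to signs.\<close>

lemma rows_combination:
  "(\<Sum>i<L + N. Polynomial.smult (v i) (rows i))
    = (\<Sum>i<M. Polynomial.monom (v i) i)
      + [:1, 1:] ^ L * (\<Sum>i<N. Polynomial.monom (v (M + i)) i)
      + Polynomial.monom 1 (M + N) * (\<Sum>i<P_degree. Polynomial.monom (v (M + N + i)) i)
      + [:1, 1:] ^ (L - r) * Polynomial.monom 1 j * (\<Sum>i<N + r - j. Polynomial.monom (v (L - r + j + i)) i)"
proof -
  let ?f = "\<lambda>i. Polynomial.smult (v i) (rows i)"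
  have "(\<Sum>i<L + N. ?f i) = (\<Sum>i<M. ?f i) + (\<Sum>i<N. ?f (M + i)) + (\<Sum>i<P_degree. ?f (M + N + i))
      + (\<Sum>i<N + r - j. ?f (L - r + j + i))"
    unfolding row_counts(2)[symmetric] sum_lessThan_add
    by (simp add: add.assoc flip: row_counts(1))
  also have "(\<Sum>i<M. ?f i) = (\<Sum>i<M. Polynomial.monom (v i) i)"
    using row_counts by (intro sum.cong) (auto simp: pade_rows_def smult_monom)
  also have "(\<Sum>i<N. ?f (M + i)) = [:1, 1:] ^ L * (\<Sum>i<N. Polynomial.monom (v (M + i)) i)"
    by (simp add: pade_rows_def sum_distrib_left smult_step_pow)
  also have "(\<Sum>i<P_degree. ?f (M + N + i)) = Polynomial.monom 1 (M + N) * (\<Sum>i<P_degree. Polynomial.monom (v (M + N + i)) i)"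
    unfolding monom_mult_sum_monom
    using row_counts by (intro sum.cong) (auto simp: pade_rows_def smult_monom)
  also have "(\<Sum>i<N + r - j. ?f (L - r + j + i))
     = [:1, 1:] ^ (L - r) * Polynomial.monom 1 j * (\<Sum>i<N + r - j. Polynomial.monom (v (L - r + j + i)) i)"
  proof -
    have "rows (L - r + j + i) = step_pow (L - r) (j + i)" for i
      using row_counts(1) by (simp add: pade_rows_def)
    then show ?thesis
      unfolding mult.assoc monom_mult_sum_monom by (simp add: sum_distrib_left smult_step_pow)
  qed
  finally show ?thesis .
qed

lemma degree_rows:
  assumes "i < L + N"
  shows "degree (rows i) < L + N"
  using assms M_less r_less row_counts(1) by (auto simp: pade_rows_def step_pow_monic degree_monom_eq)

lemma hermite_pade_iff:
  "hermite_pade (int L) (int M) (int N) (int r) (int j) (q, p, P) \<longleftrightarrow>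
     degree q < M \<and> degree p < N + r - j \<and> degree P = P_degree \<and> lead_coeff P = 1 \<and>
     [:1, 1:] ^ L dvd q - Polynomial.monom 1 (M + N) * P + [:1, 1:] ^ (L - r) * Polynomial.monom 1 j * p"
proof -
  have eq: "poly (q - Polynomial.monom 1 (M + N) * P + [:1, 1:] ^ (L - r) * Polynomial.monom 1 j * p)
      = (\<lambda>z. poly q z - z ^ nat (int M + int N) * poly P z
          + (1 + z) ^ nat (int L - int r) * z ^ nat (int j) * poly p z)"
  proof -
    have "nat (int L - int r) = L - r" "nat (int M + int N) = M + N" using r_less by auto
    then show ?thesis by (simp add: poly_monom fun_eq_iff)
  qed
  have dvd: "[:1, 1:] ^ L dvd q - Polynomial.monom 1 (M + N) * P + [:1, 1:] ^ (L - r) * Polynomial.monom 1 j * p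
    \<longleftrightarrow> (\<lambda>z. poly q z - z ^ nat (int M + int N) * poly P z
          + (1 + z) ^ nat (int L - int r) * z ^ nat (int j) * poly p z) \<in> O[at (- 1)](\<lambda>z. (z + 1) ^ nat (int L))"
    unfolding poly_bigo_iff_dvd[symmetric] eq by (simp only: nat_int)
  have "int (degree q) \<le> int M - 1 \<longleftrightarrow> degree q < M" using M_pos by linarith
  moreover have "int (degree p) \<le> int N - 1 + int r - int j \<longleftrightarrow> degree p < N + r - j"
    using j_upper by linarith
  moreover have "int (degree P) = int L - int M - int N + int j - int r \<longleftrightarrow> degree P = P_degree"
    using row_counts(1) r_less by linarith
  ultimately show ?thesis
    unfolding hermite_pade_def prod.case dvd by simp
qed

text \<open>The coefficients with which a solution represents \<open>z\<^sup>L\<^sup>-\<^sup>r\<^sup>+\<^sup>j\<close>, which is the leading term of \<open>z\<^sup>M\<^sup>+\<^sup>N P\<close>; here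
\<open>s\<close> is the quotient of the error term by \<open>(1 + z)\<^sup>L\<close>.\<close>

definition solution_coeffs :: "complex poly \<Rightarrow> complex poly \<Rightarrow> complex poly \<Rightarrow> complex poly \<Rightarrow> nat \<Rightarrow> complex" where
  "solution_coeffs q p P s i =
    (if i < M then coeff q i else if i < M + N then - coeff s (i - M)
     else if i < L - r + j then - coeff P (i - (M + N)) else coeff p (i - (L - r + j)))"

text \<open>All terms have degree less than \<open>L + N\<close>, hence the quotient of the error term by \<open>(1 + z)\<^sup>L\<close> has degree
less than \<open>N\<close> and is covered by the \<open>N\<close> rows \<open>(1 + z)\<^sup>L z\<^sup>i\<close>.\<close>

lemma solution_gives_combination:
  assumes sol: "hermite_pade (int L) (int M) (int N) (int r) (int j) (q, p, P)"
  shows "\<exists>s. Polynomial.monom 1 (L - r + j) = (\<Sum>i<L + N. Polynomial.smult (solution_coeffs q p P s i) (rows i))"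
proof -
  note sol = sol[unfolded hermite_pade_iff]
  define R where "R = q - Polynomial.monom 1 (M + N) * P + [:1, 1:] ^ (L - r) * Polynomial.monom 1 j * p"
  obtain s where s: "R = [:1, 1:] ^ L * s" using sol unfolding R_def by (blast elim: dvdE)
  have "degree (Polynomial.monom 1 (M + N) * P) < L + N"
    using sol row_counts j_upper degree_mult_le[of "Polynomial.monom 1 (M + N)" P] by (auto simp: degree_monom_eq)
  moreover have "degree ([:1, 1:] ^ (L - r) * Polynomial.monom 1 j * p) < L + N"
  proof -
    have "degree ([:1, 1:] ^ (L - r) * Polynomial.monom 1 j * p) \<le> (L - r + j) + degree p"
      using degree_mult_le[of "step_pow (L - r) j" p] by (simp add: step_pow_monic) (simp add: step_pow_def)
    then show ?thesis using sol j_upper r_less by linarith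
  qed
  moreover have "degree q < L + N" using sol M_less by auto
  ultimately have degR: "degree R < L + N"
    unfolding R_def by (intro degree_add_less degree_diff_less)
  have s0: "coeff s i = 0" if "N \<le> i" for i
  proof (cases "s = 0")
    case False
    have "degree R = L + degree s"
      unfolding s using False by (subst degree_mult_eq) (auto simp: degree_power_eq)
    then show ?thesis using degR that by (intro coeff_eq_0) auto
  qed simp
  have q0: "coeff q i = 0" if "M \<le> i" for i using sol that by (intro coeff_eq_0) auto
  have p0: "coeff p i = 0" if "N + r - j \<le> i" for i using sol that by (intro coeff_eq_0) auto
  \<comment> \<open>\<open>P\<close> is monic, so subtracting its leading term leaves only lower terms.\<close>
  have P0: "coeff (Polynomial.monom 1 P_degree - P) i = 0" if "P_degree \<le> i" for i
    using sol that by (cases "i = P_degree") (auto intro: coeff_eq_0)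
  let ?v = "solution_coeffs q p P s"
  have "(\<Sum>i<L + N. Polynomial.smult (?v i) (rows i))
    = q + [:1, 1:] ^ L * (- s) + Polynomial.monom 1 (M + N) * (Polynomial.monom 1 P_degree - P)
      + [:1, 1:] ^ (L - r) * Polynomial.monom 1 j * p"
  proof -
    have "(\<Sum>i<M. Polynomial.monom (?v i) i) = q"
      using sum_monom_coeff[of M q] q0 by (simp add: solution_coeffs_def)
    moreover have "(\<Sum>i<N. Polynomial.monom (?v (M + i)) i) = - s"
      using sum_monom_coeff[of N "- s"] s0 by (simp add: solution_coeffs_def)
    moreover have "(\<Sum>i<P_degree. Polynomial.monom (?v (M + N + i)) i) = Polynomial.monom 1 P_degree - P"
    proof -
      have "(\<Sum>i<P_degree. Polynomial.monom (?v (M + N + i)) i)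
          = (\<Sum>i<P_degree. Polynomial.monom (coeff (Polynomial.monom 1 P_degree - P) i) i)"
        using row_counts(1) by (intro sum.cong) (auto simp: solution_coeffs_def)
      then show ?thesis using sum_monom_coeff[of P_degree "Polynomial.monom 1 P_degree - P"] P0 by simp
    qed
    moreover have "(\<Sum>i<N + r - j. Polynomial.monom (?v (L - r + j + i)) i) = p"
    proof -
      have "?v (L - r + j + i) = coeff p i" for i
        using row_counts(1) by (auto simp: solution_coeffs_def)
      then show ?thesis using sum_monom_coeff[of "N + r - j" p] p0 by simp
    qed
    ultimately show ?thesis by (simp only: rows_combination)
  qed
  also have "\<dots> = R - [:1, 1:] ^ L * s + Polynomial.monom 1 (M + N + P_degree)"
    by (simp add: R_def right_diff_distrib mult_monom)
  finally have "Polynomial.monom 1 (L - r + j) = (\<Sum>i<L + N. Polynomial.smult (?v i) (rows i))"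
    by (simp add: s row_counts(1))
  then show ?thesis by blast
qed

lemma combination_gives_solution:
  assumes v: "Polynomial.monom 1 (L - r + j) = (\<Sum>i<L + N. Polynomial.smult (v i) (rows i))"
  shows "\<exists>s. hermite_pade (int L) (int M) (int N) (int r) (int j) s"
proof -
  define q where "q = (\<Sum>i<M. Polynomial.monom (v i) i)"
  define s where "s = (\<Sum>i<N. Polynomial.monom (v (M + i)) i)"
  define T where "T = (\<Sum>i<P_degree. Polynomial.monom (v (M + N + i)) i)"
  define p where "p = (\<Sum>i<N + r - j. Polynomial.monom (v (L - r + j + i)) i)"
  define P where "P = Polynomial.monom 1 P_degree - T"
  have coeff_P: "coeff P i = 0" if "P_degree < i" for i
    using that by (simp add: P_def T_def coeff_sum_monom)
  have cP: "coeff P P_degree = 1" by (simp add: P_def T_def coeff_sum_monom)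
  have "degree P = P_degree"
    by (intro antisym degree_le le_degree) (use coeff_P cP in auto)
  moreover have "lead_coeff P = 1" using cP calculation by simp
  moreover have "degree q < M"
    using degree_lessI[of q M] M_pos by (auto simp: q_def coeff_sum_monom)
  moreover have "degree p < N + r - j"
    using degree_lessI[of p "N + r - j"] j_upper by (auto simp: p_def coeff_sum_monom)
  moreover have "q - Polynomial.monom 1 (M + N) * P + [:1, 1:] ^ (L - r) * Polynomial.monom 1 j * p
      = [:1, 1:] ^ L * (- s)"
    using v unfolding rows_combination
    by (simp add: P_def right_diff_distrib mult_monom row_counts(1) flip: q_def s_def T_def p_def)
  then have "[:1, 1:] ^ L dvd q - Polynomial.monom 1 (M + N) * P + [:1, 1:] ^ (L - r) * Polynomial.monom 1 j * p"
    by simp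
  ultimately show ?thesis using hermite_pade_iff by blast
qed

text \<open>Putting \<open>z\<^sup>L\<^sup>-\<^sup>r\<^sup>+\<^sup>j\<close> into the row of \<open>(1 + z)\<^sup>L\<^sup>-\<^sup>r z\<^sup>j\<close> yields the rows for \<open>j + 1\<close>.\<close>

lemma cramer_coefficient:
  assumes v: "Polynomial.monom 1 (L - r + j) = (\<Sum>i<L + N. Polynomial.smult (v i) (rows i))"
  shows "v (L - r + j) * pade_det L M N r j (\<lambda>i. step_pow L i)
    = pade_det L M N r (Suc j) (\<lambda>i. step_pow L i)"
proof -
  let ?g = "Polynomial.monom 1 (L - r + j)"
  have "v (L - r + j) * pade_det L M N r j (\<lambda>i. step_pow L i) = poly_det (L + N) (rows(L - r + j := ?g))"
    unfolding pade_det_def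
    by (rule poly_det_cramer[symmetric, OF _ v]) (use j_upper r_less in auto)
  also have "\<dots> = pade_det L M N r (Suc j) (\<lambda>i. step_pow L i)"
    unfolding pade_det_def
    by (rule poly_det_cong) (use row_counts(1) in \<open>auto simp: pade_rows_def\<close>)
  finally show ?thesis .
qed

lemma pade_det_nonzero: "pade_det L M N r j (\<lambda>i. step_pow L i) \<noteq> 0"
proof -
  have "full_path_families L M N r j \<noteq> {}"
    using full_path_families_nonempty M_less r_less j_lower by blast
  moreover have "finite (full_path_families L M N r j)"
    using finite_path_families[OF r_pos] by (simp add: full_path_families_def)
  ultimately show ?thesis
    using pade_det_eq_card M_less r_pos r_less j_lower j_upper by (simp add: card_eq_0_iff)
qed

text \<open>Existence holds since the rows span; two solutions have equal coefficients since Cramer's rule determines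
them.\<close>

lemma hermite_pade_ex1: "\<exists>!s. hermite_pade (int L) (int M) (int N) (int r) (int j) s"
proof (rule ex_ex1I)
  have "degree (Polynomial.monom (1::complex) (L - r + j)) < L + N"
    using j_upper r_less by (simp add: degree_monom_eq)
  then obtain v where "Polynomial.monom 1 (L - r + j) = (\<Sum>i<L + N. Polynomial.smult (v i) (rows i))"
    using poly_det_nonzero_spans[OF pade_det_nonzero[unfolded pade_det_def] degree_rows] by blast
  then show "\<exists>s. hermite_pade (int L) (int M) (int N) (int r) (int j) s"
    by (rule combination_gives_solution)
next
  fix t t'
  assume t: "hermite_pade (int L) (int M) (int N) (int r) (int j) t"
    and t': "hermite_pade (int L) (int M) (int N) (int r) (int j) t'"
  obtain q p P where tt: "t = (q, p, P)" by (cases t)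
  obtain q' p' P' where tt': "t' = (q', p', P')" by (cases t')
  obtain s where s: "Polynomial.monom 1 (L - r + j) = (\<Sum>i<L + N. Polynomial.smult (solution_coeffs q p P s i) (rows i))"
    using solution_gives_combination t tt by blast
  obtain s' where s': "Polynomial.monom 1 (L - r + j) = (\<Sum>i<L + N. Polynomial.smult (solution_coeffs q' p' P' s' i) (rows i))"
    using solution_gives_combination t' tt' by blast
  have eq: "solution_coeffs q p P s i = solution_coeffs q' p' P' s' i" if "i < L + N" for i
  proof -
    have "solution_coeffs q p P s i * pade_det L M N r j (\<lambda>i. step_pow L i)
        = solution_coeffs q' p' P' s' i * pade_det L M N r j (\<lambda>i. step_pow L i)"
      unfolding pade_det_def
      by (rule trans[OF poly_det_cramer[OF that s, symmetric] poly_det_cramer[OF that s']])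
    then show ?thesis using pade_det_nonzero by simp
  qed
  note f = t[unfolded tt hermite_pade_iff] and f' = t'[unfolded tt' hermite_pade_iff]
  have "q = q'"
  proof (rule poly_eqI)
    fix i show "coeff q i = coeff q' i"
    proof (cases "i < M")
      case True then show ?thesis using eq[of i] M_less by (simp add: solution_coeffs_def)
    next
      case False then show ?thesis using f f' by (simp add: coeff_eq_0)
    qed
  qed
  moreover have "p = p'"
  proof (rule poly_eqI)
    fix i show "coeff p i = coeff p' i"
    proof (cases "i < N + r - j")
      case True
      then have "L - r + j + i < L + N" using r_less by linarith
      moreover have "solution_coeffs q p P s (L - r + j + i) = coeff p i" for q p P s
        using row_counts(1) by (auto simp: solution_coeffs_def)
      ultimately show ?thesis using eq[of "L - r + j + i"] by simp
    next
      case False then show ?thesis using f f' by (simp add: coeff_eq_0)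
    qed
  qed
  moreover have "P = P'"
  proof (rule poly_eqI)
    fix i
    consider "i < P_degree" | "i = P_degree" | "P_degree < i" by linarith
    then show "coeff P i = coeff P' i"
    proof cases
      case 1
      then have "M + N + i < L + N" using row_counts by linarith
      moreover have "solution_coeffs q p P s (M + N + i) = - coeff P i" for q p P s
        using 1 row_counts(1) by (auto simp: solution_coeffs_def)
      ultimately show ?thesis using eq[of "M + N + i"] by simp
    next
      case 2 then show ?thesis using f f' by auto
    next
      case 3 then show ?thesis using f f' by (simp add: coeff_eq_0)
    qed
  qed
  ultimately show "t = t'" by (simp add: tt tt')
qed

theorem hermite_pade_p_at_0:
  "poly (hermite_pade_p (int L) (int M) (int N) (int r) (int j)) 0
    = of_nat (card (full_path_families L M N r (Suc j))) / of_nat (card (full_path_families L M N r j))"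
proof -
  let ?D = "\<lambda>j. pade_det L M N r j (\<lambda>i. step_pow L i)"
  obtain q p P where sol: "hermite_pade (int L) (int M) (int N) (int r) (int j) (q, p, P)"
    and the: "(THE s. hermite_pade (int L) (int M) (int N) (int r) (int j) s) = (q, p, P)"
    using theI'[OF hermite_pade_ex1] by (metis prod_cases3)
  obtain s where "Polynomial.monom 1 (L - r + j) = (\<Sum>i<L + N. Polynomial.smult (solution_coeffs q p P s i) (rows i))"
    using solution_gives_combination[OF sol] by blast
  from cramer_coefficient[OF this] have "coeff p 0 * ?D j = ?D (Suc j)"
    using row_counts(1) by (simp add: solution_coeffs_def split: if_splits)
  then have "coeff p 0 = ?D (Suc j) / ?D j"
    using pade_det_nonzero by (simp add: field_simps)
  then show ?thesis
    using M_less r_pos r_less j_lower j_upper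
    by (simp add: hermite_pade_p_def the poly_0_coeff_0 pade_det_eq_card)
qed

end

section \<open>The product formula\<close>

theorem theorem1p6:
  fixes L M N r k :: int
  assumes "L > 0" and "M > 0" and "N > 0" and "M < L"
    and "r \<in> {1..L - 1}"
    and "max N (N - L + M + r) \<le> k" and "k \<le> min (M + N - 1) (r + N - 1)"
  shows "(of_nat (G_red L M N r k) :: complex) =
    of_nat (G_hex L M N) *
    (\<Prod>j = k..min (M + N - 1) (r + N - 1). 1 / poly (hermite_pade_p L M N r j) 0)"
proof -
  obtain l m n s t :: nat where nats: "L = int l" "M = int m" "N = int n" "r = int s" "k = int t"
    using assms by (metis atLeastAtMost_iff max.bounded_iff order.trans zero_le_imp_eq_int less_imp_le zero_le_one)
  \<comment> \<open>The first cut that removes nothing from the hexagon.\<close>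
  define J where "J = min (m + n) (s + n)"
  have ineq: "0 < m" "0 < n" "m < l" "0 < s" "s < l" "n \<le> t" "m + n + s \<le> l + t" "t < m + n" "t < n + s" "t < J"
    using assms unfolding nats by (auto simp: J_def)
  define G where "G j = (of_nat (card (full_path_families l m n s j)) :: complex)" for j
  have red: "of_nat (G_red L M N r k) = G t"
    unfolding G_red_def nats G_def using num_tilings_reduced_hexagon ineq by simp
  have hex: "of_nat (G_hex L M N) = G J"
  proof -
    have "hexagon L M N = reduced_hexagon (int l) (int m) (int n) (int s) (int J)"
      unfolding nats J_def using hexagon_eq_reduced[of "int m" "int n" "int l" "int s"] ineq
      by (simp add: min_def)
    then show ?thesis
      unfolding G_hex_def G_def using ineq by (subst num_tilings_reduced_hexagon[symmetric]) (auto simp: J_def)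
  qed
  have step: "1 / poly (hermite_pade_p L M N r (int j)) 0 = G j / G (Suc j)" and nz: "G j \<noteq> 0"
    if "t \<le> j" "j < J" for j
  proof -
    interpret pade l m n s j by unfold_locales (use ineq that in \<open>auto simp: J_def\<close>)
    show "1 / poly (hermite_pade_p L M N r (int j)) 0 = G j / G (Suc j)"
      unfolding nats G_def hermite_pade_p_at_0 by simp
    show "G j \<noteq> 0"
      using pade_det_nonzero pade_det_eq_card[of m l s n j] ineq that by (simp add: G_def J_def)
  qed
  have nzJ: "G J \<noteq> 0"
    unfolding G_def using full_path_families_nonempty[of m l s n J] finite_path_families[of s n J l] ineq
    by (simp add: full_path_families_def card_eq_0_iff J_def)
  have tele: "(\<Prod>j = t..<J'. G j / G (Suc j)) = G t / G J'" if "t \<le> J'" "J' \<le> J" for J'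
    using that
  proof (induction J' rule: dec_induct)
    case base
    then show ?case using nz[of t] ineq by simp
  next
    case (step J')
    then show ?case using nz[of J'] by (simp add: prod.atLeastLessThan_Suc)
  qed
  have "{k..min (M + N - 1) (r + N - 1)} = int ` {t..<J}"
    unfolding nats image_int_atLeastLessThan by (auto simp: J_def)
  then have "(\<Prod>j = k..min (M + N - 1) (r + N - 1). 1 / poly (hermite_pade_p L M N r j) 0)
      = (\<Prod>j = t..<J. 1 / poly (hermite_pade_p L M N r (int j)) 0)"
    by (simp add: prod.reindex)
  also have "\<dots> = (\<Prod>j = t..<J. G j / G (Suc j))"
    using step by (intro prod.cong) auto
  also have "\<dots> = G t / G J" using tele ineq by simp
  finally show ?thesis
    unfolding red hex using nzJ by simp
qed

end
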